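(* There is a two-sided, adaptive distribution-free testing algorithm for total orderings that makes $\tilde{O}(\sqrt{n}/\varepsilon)$ queries. On the other hand, there is a constant $\varepsilon_0>0$ such that for every constant $0<\varepsilon\le\varepsilon_0$, any such testing algorithm for total orderings with distance parameter $\varepsilon$ must make $\Omega(\sqrt{n})$ queries.
   Context: A comparison function $<_\sigma$ over $[n]$ assigns to each unordered pair $\{u,v\}$ of distinct elements one of $u<_\sigma v$ or $v<_\sigma u$ (equivalently, a tournament on $[n]$; it need not be transitive). The testing problem: the algorithm gets $\varepsilon>0$, oracle access to $<_\sigma$ (querying a pair $\{u,v\}$ reveals which of $u<_\sigma v$, $v<_\sigma u$ holds) and sampling access to an unknown distribution $\mathcal{D}$ over the $\binom n2$ two-element subsets of $[n]$. It must accept with probability at least $2/3$ if $<_\sigma$ is a total ordering, and reject with probability at least $2/3$ if $<_\sigma$ is $\varepsilon$-far from total orderings w.r.t. $\mathcal{D}$, meaning that for every total ordering $<_\tau$ of $[n]$, $\Pr_{\{u,v\}\sim\mathcal{D}}[<_\sigma\text{ and }<_\tau\text{ order }u,v\text{ differently}]\ge\varepsilon$. The query complexity counts both oracle queries and samples. $\tilde O$ hides polylogarithmic factors. *)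

theory Defs
  imports "HOL-Probability.Probability" "HOL-Library.Ramsey"
begin

text \<open>A comparison function on \<open>[n] = {1..n}\<close> is encoded by the set of pairs \<open>(u, v)\<close> with
  \<open>u <\<^sub>\<sigma> v\<close>.  Requiring \<open>\<sigma> \<subseteq> {1..n} \<times> {1..n}\<close> makes the encoding unique; in particular, looking
  up a pair outside \<open>[n]\<close> or a pair \<open>(u, u)\<close> always gives \<open>False\<close> and so reveals nothing.\<close>

definition comparison_function :: "nat \<Rightarrow> (nat \<times> nat) set \<Rightarrow> bool" where
  "comparison_function n \<sigma> \<longleftrightarrow> \<sigma> \<subseteq> {1..n} \<times> {1..n} \<and> total_on {1..n} \<sigma> \<and> asym \<sigma>"

definition total_ordering :: "nat \<Rightarrow> (nat \<times> nat) set \<Rightarrow> bool" where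
  "total_ordering n \<sigma> \<longleftrightarrow> \<sigma> \<subseteq> {1..n} \<times> {1..n} \<and> strict_linear_order_on {1..n} \<sigma>"

lemma total_ordering_iff: "total_ordering n \<sigma> \<longleftrightarrow> comparison_function n \<sigma> \<and> trans \<sigma>"
  unfolding total_ordering_def comparison_function_def strict_linear_order_on_def
  by (meson asym_on_iff_irrefl_on_if_trans_on trans_on_subset subset_UNIV)

definition pair_distribution :: "nat \<Rightarrow> nat set pmf \<Rightarrow> bool" where
  "pair_distribution n D \<longleftrightarrow> set_pmf D \<subseteq> nsets {1..n} 2"

definition disagreements :: "(nat \<times> nat) set \<Rightarrow> (nat \<times> nat) set \<Rightarrow> nat set set" where
  "disagreements \<sigma> \<tau> = {{u, v} | u v. (u, v) \<in> \<sigma> \<and> (v, u) \<in> \<tau>}"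

definition far_from_total_orderings ::
    "nat \<Rightarrow> real \<Rightarrow> nat set pmf \<Rightarrow> (nat \<times> nat) set \<Rightarrow> bool" where
  "far_from_total_orderings n \<epsilon> D \<sigma> \<longleftrightarrow>
     (\<forall>\<tau>. total_ordering n \<tau> \<longrightarrow> measure_pmf.prob D (disagreements \<sigma> \<tau>) \<ge> \<epsilon>)"

text \<open>A deterministic adaptive strategy: each oracle query and each request for a sample may depend
  on all answers and samples seen so far.  A sample is an unordered pair and does not come with its
  orientation under \<open>\<sigma>\<close>.  \<open>Output True\<close> means accept.\<close>

datatype strategy =
    Output bool
  | Query nat nat "bool \<Rightarrow> strategy"
  | Sample "nat set \<Rightarrow> strategy"

text \<open>The joint distribution of the verdict and of the number of oracle queries plus samples.\<close>

primrec run :: "(nat \<times> nat) set \<Rightarrow> nat set pmf \<Rightarrow> strategy \<Rightarrow> (bool \<times> nat) pmf" where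
  "run \<sigma> D (Output b) = return_pmf (b, 0)"
| "run \<sigma> D (Query u v k) = map_pmf (apsnd Suc) (run \<sigma> D (k ((u, v) \<in> \<sigma>)))"
| "run \<sigma> D (Sample k) = bind_pmf D (\<lambda>e. map_pmf (apsnd Suc) (run \<sigma> D (k e)))"

text \<open>A randomized algorithm is a probability distribution over deterministic strategies: all
  internal randomness is drawn in advance, independently of the samples.\<close>

definition execute ::
    "strategy pmf \<Rightarrow> (nat \<times> nat) set \<Rightarrow> nat set pmf \<Rightarrow> (bool \<times> nat) pmf" where
  "execute A \<sigma> D = bind_pmf A (run \<sigma> D)"

definition distribution_free_tester :: "nat \<Rightarrow> real \<Rightarrow> strategy pmf \<Rightarrow> bool" where
  "distribution_free_tester n \<epsilon> A \<longleftrightarrow>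
     (\<forall>\<sigma> D. comparison_function n \<sigma> \<and> pair_distribution n D \<longrightarrow>
        (total_ordering n \<sigma> \<longrightarrow>
           measure_pmf.prob (execute A \<sigma> D) {(b, q). b} \<ge> 2 / 3) \<and>
        (far_from_total_orderings n \<epsilon> D \<sigma> \<longrightarrow>
           measure_pmf.prob (execute A \<sigma> D) {(b, q). \<not> b} \<ge> 2 / 3))"

text \<open>Worst-case complexity: over all inputs and all outcomes of the samples and of the internal
  randomness.\<close>

definition makes_at_most_queries :: "nat \<Rightarrow> strategy pmf \<Rightarrow> real \<Rightarrow> bool" where
  "makes_at_most_queries n A B \<longleftrightarrow>
     (\<forall>\<sigma> D. comparison_function n \<sigma> \<and> pair_distribution n D \<longrightarrow>
        (\<forall>(b, q) \<in> set_pmf (execute A \<sigma> D). real q \<le> B))"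

text \<open>The functions allowed by soft-O notation: \<open>soft_bound C k g = C g log\<^sup>k g\<close>, with the argument of the
  logarithm shifted by 2 so that the factor stays bounded away from 0 when \<open>g\<close> is close to 1.\<close>

definition soft_bound :: "real \<Rightarrow> nat \<Rightarrow> real \<Rightarrow> real" where
  "soft_bound C k g = C * g * ln (2 + g) ^ k"

end

theory Submission imports Defs "HOL-Library.Tree" begin

text \<open>Upper bound.  The smaller endpoints of \<open>m\<close> sampled pairs are inserted as pivots into a quicksort
  tree by querying \<open>\<sigma>\<close>; then \<open>s\<close> fresh pairs are located in the tree, and the tester rejects if some
  pair is separated by a pivot with which it forms a cyclic triangle.  Let \<open>\<Phi>\<close> be the \<open>D\<close>-mass of
  such pairs.  Inserting all remaining elements as pivots yields a total ordering, so if \<open>\<sigma>\<close> is far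
  and \<open>\<Phi>\<close> is small, then the gains in \<open>\<Phi>\<close> of the individual elements sum up to at least about \<open>\<epsilon>\<close>.
  Discarding the rarely sampled elements and (if they are rare) those of gain at least \<open>\<theta>\<close>, one sees
  that a random pivot has truncated expected gain at least of order \<open>\<epsilon>\<^sup>2 / n\<close>.  Hence after order
  \<open>\<surd>n / \<epsilon>\<close> pivots \<open>\<Phi>\<close> is likely to exceed \<open>\<theta>\<close> of order \<open>\<epsilon> / \<surd>n\<close>, and order \<open>\<surd>n / \<epsilon>\<close> fresh pairs
  suffice to notice this.  The expected depth of the tree is logarithmic even if \<open>\<sigma>\<close> is not
  transitive, because of three elements of a tournament one always separates the other two.

  Lower bound.  Hide a random partition of \<open>[n]\<close> into triples that are consecutive in a random order,
  let \<open>D\<close> be uniform on pairs inside triples, and orient every triple either transitively or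
  cyclically.  The two cases can only be told apart after two samples from the same triple, or after a
  query or sample has met a triple touched before, which is unlikely within \<open>o(\<surd>n)\<close> steps.\<close>

section \<open>Strategies\<close>

lemma measure_bind_pmf_eq:
  "measure_pmf.prob (bind_pmf M N) X = measure_pmf.expectation M (\<lambda>x. measure_pmf.prob (N x) X)"
proof -
  have int: "integrable (measure_pmf M) (\<lambda>x. measure_pmf.prob (N x) X)"
    by (rule measure_pmf.integrable_const_bound[where B = 1]) auto
  have "ennreal (measure_pmf.prob (bind_pmf M N) X)
      = (\<integral>\<^sup>+x. ennreal (measure_pmf.prob (N x) X) \<partial>measure_pmf M)"
    by (simp add: measure_pmf.emeasure_eq_measure[symmetric])
  also have "\<dots> = ennreal (measure_pmf.expectation M (\<lambda>x. measure_pmf.prob (N x) X))"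
    by (rule nn_integral_eq_integral[OF int]) simp
  finally show ?thesis
    by (simp add: integral_nonneg_AE)
qed

text \<open>Replaces the probability space of runs by a recursion over the strategy, so that
  acceptance probabilities can be compared by structural induction.\<close>

primrec acceptance :: "(nat \<times> nat) set \<Rightarrow> nat set pmf \<Rightarrow> strategy \<Rightarrow> real" where
  "acceptance \<sigma> D (Output b) = of_bool b"
| "acceptance \<sigma> D (Query u v k) = acceptance \<sigma> D (k ((u, v) \<in> \<sigma>))"
| "acceptance \<sigma> D (Sample k) = measure_pmf.expectation D (\<lambda>e. acceptance \<sigma> D (k e))"

lemma prob_run_accept: "measure_pmf.prob (run \<sigma> D s) {(b, q). b} = acceptance \<sigma> D s"
proof (induction s)
  case (Output b)
  then show ?case by (simp add: indicator_def)
next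
  case (Query u v k)
  have "apsnd Suc -` {(b, q :: nat). b} = {(b :: bool, q). b}" by auto
  then show ?case using Query by simp
next
  case (Sample k)
  have *: "apsnd Suc -` {(b, q :: nat). b} = {(b :: bool, q). b}" by auto
  show ?case by (simp add: measure_bind_pmf_eq * Sample.IH[OF rangeI] del: vimage_Collect_eq)
qed

lemma prob_execute_accept:
  "measure_pmf.prob (execute A \<sigma> D) {(b, q). b} = measure_pmf.expectation A (acceptance \<sigma> D)"
  by (simp add: execute_def measure_bind_pmf_eq prob_run_accept)

lemma prob_reject: "measure_pmf.prob p {(b, q). \<not> b} = 1 - measure_pmf.prob p {(b, q). b}"
proof -
  have *: "{(b, q). \<not> b} = UNIV - {(b :: bool, q). b}" by auto
  show ?thesis unfolding * using measure_pmf.prob_compl[of "{(b, q). b}" p] by simp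
qed

lemma acceptance_nonneg: "0 \<le> acceptance \<sigma> D s"
  and acceptance_le_1: "acceptance \<sigma> D s \<le> 1"
  by (simp_all flip: prob_run_accept)

text \<open>An exhausted budget leads to acceptance, which keeps the error of the tester one-sided.
  In the lower bound the budget serves as an induction parameter.\<close>

primrec truncate :: "strategy \<Rightarrow> nat \<Rightarrow> strategy" where
  "truncate (Output b) q = Output b"
| "truncate (Query u v k) q =
    (case q of 0 \<Rightarrow> Output True | Suc r \<Rightarrow> Query u v (\<lambda>a. truncate (k a) r))"
| "truncate (Sample k) q =
    (case q of 0 \<Rightarrow> Output True | Suc r \<Rightarrow> Sample (\<lambda>e. truncate (k e) r))"

lemma queries_truncate: "(b, r) \<in> set_pmf (run \<sigma> D (truncate s q)) \<Longrightarrow> r \<le> q"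
proof (induction s arbitrary: q b r)
  case (Output b)
  then show ?case by simp
next
  case (Query u v k)
  then show ?case
    by (cases q) (auto simp: apsnd_def map_prod_def dest!: Query.IH[OF rangeI])
next
  case (Sample k)
  then show ?case
    by (cases q) (auto simp: apsnd_def map_prod_def dest!: Sample.IH[OF rangeI])
qed

text \<open>A strategy that respects the budget on the given input never reaches the default verdict
  there.\<close>

lemma run_truncate:
  assumes "\<And>b r. (b, r) \<in> set_pmf (run \<sigma> D s) \<Longrightarrow> r \<le> q"
  shows "run \<sigma> D (truncate s q) = run \<sigma> D s"
  using assms
proof (induction s arbitrary: q)
  case (Output b)
  then show ?case by simp
next
  case (Query u v k)
  obtain b r where br: "(b, r) \<in> set_pmf (run \<sigma> D (k ((u, v) \<in> \<sigma>)))"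
    using set_pmf_not_empty by (metis ex_in_conv surj_pair)
  have *: "r < q" if "(b, r) \<in> set_pmf (run \<sigma> D (k ((u, v) \<in> \<sigma>)))" for b r
  proof -
    have "(b, Suc r) \<in> set_pmf (run \<sigma> D (Query u v k))" using that by force
    then show ?thesis using Query.prems by fastforce
  qed
  \<comment> \<open>The support of a pmf is nonempty, and the outcome chosen above, counted together
    with the current query, fits the budget. So the budget is positive.\<close>
  obtain p where p: "q = Suc p" using *[OF br] by (cases q) auto
  have "run \<sigma> D (truncate (k ((u, v) \<in> \<sigma>)) p) = run \<sigma> D (k ((u, v) \<in> \<sigma>))"
    using * p by (intro Query.IH[OF rangeI]) fastforce+
  then show ?case using p by simp
next
  case (Sample k)
  have *: "r < q" if "e \<in> set_pmf D" "(b, r) \<in> set_pmf (run \<sigma> D (k e))" for e b r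
  proof -
    have "(b, Suc r) \<in> set_pmf (run \<sigma> D (Sample k))" using that by force
    then show ?thesis using Sample.prems by fastforce
  qed
  obtain e where e: "e \<in> set_pmf D" using set_pmf_not_empty by (metis ex_in_conv)
  obtain b r where "(b, r) \<in> set_pmf (run \<sigma> D (k e))"
    using set_pmf_not_empty by (metis ex_in_conv surj_pair)
  then obtain p where p: "q = Suc p" using *[OF e] by (cases q) auto
  have "run \<sigma> D (truncate (k e) p) = run \<sigma> D (k e)" if "e \<in> set_pmf D" for e
    using *[OF that] p by (intro Sample.IH[OF rangeI]) fastforce+
  then show ?case using p by (auto intro: bind_pmf_cong)
qed

section \<open>Quicksort trees of a tournament\<close>

primrec insert_pivot :: "(nat \<times> nat) set \<Rightarrow> nat \<Rightarrow> nat tree \<Rightarrow> nat tree" where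
  "insert_pivot \<sigma> x Leaf = Node Leaf x Leaf"
| "insert_pivot \<sigma> x (Node l w r) =
    (if x = w then Node l w r
     else if (x, w) \<in> \<sigma> then Node (insert_pivot \<sigma> x l) w r
     else Node l w (insert_pivot \<sigma> x r))"

text \<open>Only a partial equivalence relation: a pivot met on its own search path shares a leaf
  with nothing, not even with itself.\<close>

primrec same_leaf :: "(nat \<times> nat) set \<Rightarrow> nat tree \<Rightarrow> nat \<Rightarrow> nat \<Rightarrow> bool" where
  "same_leaf \<sigma> Leaf u v = True"
| "same_leaf \<sigma> (Node l w r) u v =
    (u \<noteq> w \<and> v \<noteq> w \<and>
      (if (u, w) \<in> \<sigma> then (v, w) \<in> \<sigma> \<and> same_leaf \<sigma> l u v
       else (v, w) \<notin> \<sigma> \<and> same_leaf \<sigma> r u v))"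

text \<open>Meaningful only if \<open>(u, v) \<in> \<sigma>\<close>: then the pivot separating \<open>u\<close> from \<open>v\<close> forms a cyclic triangle
  with them.\<close>

primrec violated :: "(nat \<times> nat) set \<Rightarrow> nat tree \<Rightarrow> nat \<Rightarrow> nat \<Rightarrow> bool" where
  "violated \<sigma> Leaf u v = False"
| "violated \<sigma> (Node l w r) u v =
    (u \<noteq> w \<and> v \<noteq> w \<and>
      (if (u, w) \<in> \<sigma> then (v, w) \<in> \<sigma> \<and> violated \<sigma> l u v
       else (v, w) \<in> \<sigma> \<or> violated \<sigma> r u v))"

text \<open>Elements in the same leaf are ordered as natural numbers, which makes this a strict total
  order for every \<open>\<sigma>\<close>.\<close>

primrec before :: "(nat \<times> nat) set \<Rightarrow> nat tree \<Rightarrow> nat \<Rightarrow> nat \<Rightarrow> bool" where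
  "before \<sigma> Leaf u v = (u < v)"
| "before \<sigma> (Node l w r) u v =
    (if u = w then v \<noteq> w \<and> (v, w) \<notin> \<sigma>
     else if v = w then (u, w) \<in> \<sigma>
     else if (u, w) \<in> \<sigma> then (v, w) \<in> \<sigma> \<longrightarrow> before \<sigma> l u v
     else (v, w) \<notin> \<sigma> \<and> before \<sigma> r u v)"

primrec path_length :: "(nat \<times> nat) set \<Rightarrow> nat tree \<Rightarrow> nat \<Rightarrow> nat" where
  "path_length \<sigma> Leaf u = 0"
| "path_length \<sigma> (Node l w r) u =
    Suc (if u = w then 0 else if (u, w) \<in> \<sigma> then path_length \<sigma> l u else path_length \<sigma> r u)"

definition separates :: "(nat \<times> nat) set \<Rightarrow> nat \<Rightarrow> nat \<Rightarrow> nat \<Rightarrow> bool" where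
  "separates \<sigma> x u v \<longleftrightarrow> u = x \<or> v = x \<or> ((u, x) \<in> \<sigma> \<longleftrightarrow> (v, x) \<notin> \<sigma>)"

lemma same_leaf_sym: "same_leaf \<sigma> t u v \<Longrightarrow> same_leaf \<sigma> t v u"
  by (induction t) (auto split: if_splits)

lemma same_leaf_trans: "same_leaf \<sigma> t u v \<Longrightarrow> same_leaf \<sigma> t v w \<Longrightarrow> same_leaf \<sigma> t u w"
  by (induction t) (auto split: if_splits)

text \<open>The new pivot lands in the leaf of \<open>x\<close>, so only that leaf is split. If the
  search for \<open>x\<close> ends at an existing pivot, \<open>same_leaf \<sigma> t u x\<close>
  fails and nothing changes.\<close>

lemma same_leaf_insert_pivot:
  "same_leaf \<sigma> (insert_pivot \<sigma> x t) u v \<longleftrightarrow>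
     same_leaf \<sigma> t u v \<and> \<not> (same_leaf \<sigma> t u x \<and> separates \<sigma> x u v)"
  by (induction t) (auto simp: separates_def)

lemma violated_insert_pivot:
  "violated \<sigma> (insert_pivot \<sigma> x t) u v \<longleftrightarrow>
     violated \<sigma> t u v \<or>
     same_leaf \<sigma> t u v \<and> same_leaf \<sigma> t u x \<and> u \<noteq> x \<and> v \<noteq> x \<and> (u, x) \<notin> \<sigma> \<and> (v, x) \<in> \<sigma>"
  by (induction t) auto

lemma path_length_insert_pivot:
  "path_length \<sigma> (insert_pivot \<sigma> x t) u = path_length \<sigma> t u + of_bool (same_leaf \<sigma> t u x)"
  by (induction t) auto

lemma not_same_leaf_if_violated: "violated \<sigma> t u v \<Longrightarrow> \<not> same_leaf \<sigma> t u v"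
  by (induction t) (auto split: if_splits)

lemma before_irrefl: "\<not> before \<sigma> t u u"
  by (induction t) auto

lemma before_trans: "before \<sigma> t u v \<Longrightarrow> before \<sigma> t v w \<Longrightarrow> before \<sigma> t u w"
  by (induction t) (auto split: if_splits)

lemma before_total: "u \<noteq> v \<Longrightarrow> before \<sigma> t u v \<or> before \<sigma> t v u"
  by (induction t) auto

text \<open>The two elements descend together until they reach a leaf or a pivot parts them. A split
  that puts \<open>v\<close> first although \<open>(u, v) \<in> \<sigma>\<close> is a cyclic
  triangle; the case that the pivot is one of the two is excluded by \<open>asym\<close>.\<close>

lemma violated_or_same_leaf:
  assumes "asym \<sigma>" "(u, v) \<in> \<sigma>" "before \<sigma> t v u"
  shows "violated \<sigma> t u v \<or> same_leaf \<sigma> t u v"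
  using assms(2,3) by (induction t) (auto split: if_splits dest: asymD[OF assms(1)])

section \<open>The total ordering read off a tree\<close>

definition tree_order :: "nat \<Rightarrow> (nat \<times> nat) set \<Rightarrow> nat tree \<Rightarrow> (nat \<times> nat) set" where
  "tree_order n \<sigma> t = {(u, v). u \<in> {1..n} \<and> v \<in> {1..n} \<and> before \<sigma> t u v}"

lemma total_ordering_tree_order: "total_ordering n (tree_order n \<sigma> t)"
  unfolding total_ordering_def strict_linear_order_on_def tree_order_def
  using before_trans[of \<sigma> t] before_total[of _ _ \<sigma> t]
  by (auto simp: before_irrefl irrefl_def total_on_def trans_def)

section \<open>The tester\<close>

text \<open>Continuation-passing style: the rest of the strategy, \<open>k\<close>, receives the new
  tree.\<close>

primrec insertion :: "nat \<Rightarrow> nat tree \<Rightarrow> (nat tree \<Rightarrow> strategy) \<Rightarrow> strategy" where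
  "insertion x Leaf k = k (Node Leaf x Leaf)"
| "insertion x (Node l w r) k =
    (if x = w then k (Node l w r)
     else Query x w (\<lambda>a. if a then insertion x l (\<lambda>l'. k (Node l' w r))
                         else insertion x r (\<lambda>r'. k (Node l w r'))))"

text \<open>Presupposes that \<open>(u, v) \<in> \<sigma>\<close> is known. Of the two ways in which
  a pivot can part the pair, only \<open>v\<close> before and \<open>u\<close> after it is
  cyclic.\<close>

primrec check :: "nat \<Rightarrow> nat \<Rightarrow> nat tree \<Rightarrow> (bool \<Rightarrow> strategy) \<Rightarrow> strategy" where
  "check u v Leaf k = k False"
| "check u v (Node l w r) k =
    (if u = w \<or> v = w then k False
     else Query u w (\<lambda>a. Query v w (\<lambda>b.
       if a then if b then check u v l k else k False
       else if b then k True else check u v r k)))"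

text \<open>A sample carries no orientation; the query that follows it supplies the one that
  \<open>check\<close> presupposes.\<close>

primrec checks :: "nat \<Rightarrow> nat tree \<Rightarrow> strategy" where
  "checks 0 t = Output True"
| "checks (Suc s) t = Sample (\<lambda>e. Query (Min e) (Max e) (\<lambda>a.
     check (if a then Min e else Max e) (if a then Max e else Min e) t
       (\<lambda>b. if b then Output False else checks s t)))"

primrec tree_tester :: "nat \<Rightarrow> nat \<Rightarrow> nat tree \<Rightarrow> strategy" where
  "tree_tester 0 s t = checks s t"
| "tree_tester (Suc m) s t = Sample (\<lambda>e. insertion (Min e) t (tree_tester m s))"

primrec expected_queries :: "(nat \<times> nat) set \<Rightarrow> nat set pmf \<Rightarrow> strategy \<Rightarrow> real" where
  "expected_queries \<sigma> D (Output b) = 0"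
| "expected_queries \<sigma> D (Query u v k) = 1 + expected_queries \<sigma> D (k ((u, v) \<in> \<sigma>))"
| "expected_queries \<sigma> D (Sample k) =
    1 + measure_pmf.expectation D (\<lambda>e. expected_queries \<sigma> D (k e))"

lemma expected_queries_nonneg: "0 \<le> expected_queries \<sigma> D s"
  by (induction s) (auto intro!: add_nonneg_nonneg integral_nonneg_AE)

lemma acceptance_insertion:
  "acceptance \<sigma> D (insertion x t k) = acceptance \<sigma> D (k (insert_pivot \<sigma> x t))"
  by (induction t arbitrary: k) auto

lemma expected_queries_insertion:
  "expected_queries \<sigma> D (insertion x t k)
     \<le> real (path_length \<sigma> t x) + expected_queries \<sigma> D (k (insert_pivot \<sigma> x t))"
proof (induction t arbitrary: k)
  case (Node l w r)
  show ?case
    using Node(1)[of "\<lambda>l'. k (Node l' w r)"] Node(2)[of "\<lambda>r'. k (Node l w r')"] by auto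
qed simp

lemma acceptance_check: "acceptance \<sigma> D (check u v t k) = acceptance \<sigma> D (k (violated \<sigma> t u v))"
  by (induction t) auto

text \<open>The walk ends as soon as the pair is parted, so the path of either endpoint bounds it.
  Both versions are stated because the smaller endpoint of a sample may come first or
  second.\<close>

lemma expected_queries_check:
  "expected_queries \<sigma> D (check u v t k)
     \<le> 2 * real (path_length \<sigma> t u) + expected_queries \<sigma> D (k (violated \<sigma> t u v))"
  "expected_queries \<sigma> D (check u v t k)
     \<le> 2 * real (path_length \<sigma> t v) + expected_queries \<sigma> D (k (violated \<sigma> t u v))"
  by (induction t) auto

text \<open>Markov's inequality in inductive form: truncation matters only if the budget is
  exceeded. The difference \<open>q - r\<close> is the part already spent, and \<open>r = q\<close>
  gives the usual bound.\<close>

lemma acceptance_truncate_le: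
  assumes fin: "finite (set_pmf D)" and q: "q > 0" "r \<le> q"
  shows "acceptance \<sigma> D (truncate s r)
    \<le> acceptance \<sigma> D s + (expected_queries \<sigma> D s + (real q - real r)) / real q"
  using q(2)
proof (induction s arbitrary: r)
  case (Output b)
  then show ?case by simp
next
  case (Query u v k)
  show ?case
  proof (cases r)
    case 0
    \<comment> \<open>All of \<open>q\<close> is spent and one more query is due, so the error term
      alone is at least 1.\<close>
    have "1 \<le> (1 + expected_queries \<sigma> D (k ((u, v) \<in> \<sigma>)) + real q) / real q"
      using q expected_queries_nonneg[of \<sigma> D "k ((u, v) \<in> \<sigma>)"] by simp
    then show ?thesis using 0 acceptance_nonneg[of \<sigma> D "k ((u, v) \<in> \<sigma>)"] by simp
  next
    case (Suc p)
    then show ?thesis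
      using Query.IH[OF rangeI, of p "(u, v) \<in> \<sigma>"] Query.prems by (simp add: algebra_simps)
  qed
next
  case (Sample k)
  have int: "integrable (measure_pmf D) f" for f :: "_ \<Rightarrow> real"
    by (rule integrable_measure_pmf_finite[OF fin])
  show ?case
  proof (cases r)
    case 0
    have "0 \<le> measure_pmf.expectation D (\<lambda>e. expected_queries \<sigma> D (k e))"
      by (intro integral_nonneg_AE) (simp add: expected_queries_nonneg)
    then have "1 \<le> (1 + measure_pmf.expectation D (\<lambda>e. expected_queries \<sigma> D (k e)) + real q) / real q"
      using q by simp
    moreover have "0 \<le> measure_pmf.expectation D (\<lambda>e. acceptance \<sigma> D (k e))"
      by (intro integral_nonneg_AE) (simp add: acceptance_nonneg)
    ultimately show ?thesis using 0 by simp
  next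
    case (Suc p)
    have "measure_pmf.expectation D (\<lambda>e. acceptance \<sigma> D (truncate (k e) p))
      \<le> measure_pmf.expectation D (\<lambda>e. acceptance \<sigma> D (k e)
          + (expected_queries \<sigma> D (k e) + (real q - real p)) / real q)"
      using Sample.IH[OF rangeI, of p] Sample.prems Suc by (intro integral_mono int) auto
    also have "\<dots> = measure_pmf.expectation D (\<lambda>e. acceptance \<sigma> D (k e))
        + (measure_pmf.expectation D (\<lambda>e. expected_queries \<sigma> D (k e)) + (real q - real p)) / real q"
      by (simp add: int)
    finally show ?thesis using Suc by (simp add: algebra_simps)
  qed
qed

lemma expectation_bind_finite:
  fixes h :: "'b \<Rightarrow> real"
  assumes "finite (set_pmf p)" "\<And>x. x \<in> set_pmf p \<Longrightarrow> finite (set_pmf (f x))"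
  shows "measure_pmf.expectation (bind_pmf p f) h
    = measure_pmf.expectation p (\<lambda>x. measure_pmf.expectation (f x) h)"
  using pmf_expectation_bind[OF assms(1), of f p h] assms
  by (simp add: integral_measure_pmf[OF assms(1)])

section \<open>Violated pairs\<close>

locale testing_instance =
  fixes n :: nat and \<sigma> :: "(nat \<times> nat) set" and D :: "nat set pmf"
  assumes comparison: "comparison_function n \<sigma>" and pairs: "pair_distribution n D"
begin

abbreviation E :: "(nat set \<Rightarrow> real) \<Rightarrow> real" where
  "E \<equiv> measure_pmf.expectation D"

text \<open>Using only the smaller endpoint of a sample as pivot keeps the pivots identically distributed.
  It is enough for both parts of the analysis: a pair inside a set \<open>H\<close> has its smaller endpoint in
  \<open>H\<close>, and a pair is followed down the tree only as long as its smaller endpoint is.\<close>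

definition weight :: "nat \<Rightarrow> real" where
  "weight x = measure_pmf.prob D {e. Min e = x}"

lemma asym: "asym \<sigma>" and range: "(u, v) \<in> \<sigma> \<Longrightarrow> u \<in> {1..n} \<and> v \<in> {1..n}"
  and total: "u \<in> {1..n} \<Longrightarrow> v \<in> {1..n} \<Longrightarrow> u \<noteq> v \<Longrightarrow> (u, v) \<in> \<sigma> \<or> (v, u) \<in> \<sigma>"
  using comparison unfolding comparison_function_def total_on_def by auto

lemma finite_support: "finite (set_pmf D)"
  using pairs finite_imp_finite_nsets[of "{1..n}" 2] finite_subset
  unfolding pair_distribution_def by blast

lemma integrable [simp]: "integrable (measure_pmf D) (f :: _ \<Rightarrow> real)"
  by (rule integrable_measure_pmf_finite[OF finite_support])

lemma sampled_pair:
  assumes "e \<in> set_pmf D"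
  shows "e = {Min e, Max e}" "Min e < Max e" "Min e \<in> {1..n}" "Max e \<in> {1..n}"
proof -
  have "e \<in> nsets {1..n} 2" using assms pairs unfolding pair_distribution_def by auto
  then obtain a b where ab: "a \<in> {1..n}" "b \<in> {1..n}" "a \<noteq> b" "e = {a, b}"
    by (elim nsets2_E) auto
  define x y where "x = min a b" and "y = max a b"
  have xy: "x \<in> {1..n}" "y \<in> {1..n}" "x < y" "e = {x, y}"
    using ab by (auto simp: x_def y_def min_def max_def)
  then have "Min e = x" "Max e = y" by auto
  then show "e = {Min e, Max e}" "Min e < Max e" "Min e \<in> {1..n}" "Max e \<in> {1..n}"
    using xy by auto
qed

lemma weight_nonneg: "0 \<le> weight x"
  by (simp add: weight_def)

lemma E_cong: "(\<And>e. e \<in> set_pmf D \<Longrightarrow> f e = g e) \<Longrightarrow> E f = E g"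
  by (intro integral_cong_AE) (auto simp: AE_measure_pmf_iff)

lemma E_mono: "(\<And>e. e \<in> set_pmf D \<Longrightarrow> f e \<le> g e) \<Longrightarrow> E f \<le> E g"
  by (intro integral_mono_AE) (auto simp: AE_measure_pmf_iff)

lemma prob_eq_E: "measure_pmf.prob D A = E (\<lambda>e. of_bool (e \<in> A))"
proof -
  have "(\<lambda>e. of_bool (e \<in> A)) = (indicator A :: _ \<Rightarrow> real)"
    by (auto simp: fun_eq_iff)
  then show ?thesis by simp
qed

lemma E_Min: "E (\<lambda>e. F (Min e)) = (\<Sum>x\<in>{1..n}. weight x * F x)"
proof -
  have "E (\<lambda>e. F (Min e)) = measure_pmf.expectation (map_pmf Min D) F" by simp
  also have "\<dots> = (\<Sum>x\<in>{1..n}. pmf (map_pmf Min D) x *\<^sub>R F x)"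
    by (rule integral_measure_pmf) (auto dest: sampled_pair(3))
  also have "\<dots> = (\<Sum>x\<in>{1..n}. weight x * F x)"
    by (simp add: pmf_map weight_def vimage_def)
  finally show ?thesis .
qed

lemma sum_weight: "(\<Sum>x\<in>{1..n}. weight x) = 1"
  using E_Min[of "\<lambda>_. 1"] by simp

definition contradicts :: "nat tree \<Rightarrow> nat set \<Rightarrow> bool" where
  "contradicts t e \<longleftrightarrow> (\<exists>u v. e = {u, v} \<and> (u, v) \<in> \<sigma> \<and> violated \<sigma> t u v)"

definition newly_contradicts :: "nat tree \<Rightarrow> nat \<Rightarrow> nat set \<Rightarrow> bool" where
  "newly_contradicts t x e \<longleftrightarrow>
     (\<exists>u v. e = {u, v} \<and> (u, v) \<in> \<sigma> \<and> same_leaf \<sigma> t u v \<and> same_leaf \<sigma> t u x \<and>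
        u \<noteq> x \<and> v \<noteq> x \<and> (u, x) \<notin> \<sigma> \<and> (v, x) \<in> \<sigma>)"

definition violation :: "nat tree \<Rightarrow> real" where
  "violation t = E (\<lambda>e. of_bool (contradicts t e))"

definition gain :: "nat tree \<Rightarrow> nat \<Rightarrow> real" where
  "gain t x = E (\<lambda>e. of_bool (newly_contradicts t x e))"

lemma violation_nonneg: "0 \<le> violation t" and gain_nonneg: "0 \<le> gain t x"
  by (simp_all add: violation_def gain_def integral_nonneg_AE)

lemma violation_le_1: "violation t \<le> 1"
proof -
  have "violation t \<le> E (\<lambda>_. 1)" unfolding violation_def by (rule E_mono) simp
  then show ?thesis by simp
qed

lemma contradicts_insert_pivot:
  "contradicts (insert_pivot \<sigma> x t) e \<longleftrightarrow> contradicts t e \<or> newly_contradicts t x e"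
  unfolding contradicts_def newly_contradicts_def violated_insert_pivot by blast

text \<open>A contradicted pair is already parted, whereas a new contradiction needs a pair inside
  one leaf. Hence the increment of \<open>violation\<close> is exactly \<open>gain\<close>.\<close>

lemma not_contradicts_and_newly: "contradicts t e \<Longrightarrow> \<not> newly_contradicts t x e"
  unfolding contradicts_def newly_contradicts_def
  using not_same_leaf_if_violated asymD[OF asym] by (metis doubleton_eq_iff)

lemma violation_insert_pivot: "violation (insert_pivot \<sigma> x t) = violation t + gain t x"
proof -
  have "of_bool (contradicts (insert_pivot \<sigma> x t) e)
      = (of_bool (contradicts t e) + of_bool (newly_contradicts t x e) :: real)" for e
    using contradicts_insert_pivot[of x t e] not_contradicts_and_newly[of t e x] by auto
  then show ?thesis by (simp add: violation_def gain_def)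
qed

text \<open>Refining the leaves only shrinks the set of pairs that a given pivot can newly contradict,
  so the total gain of a sequence of pivots is at most the sum of their gains at the start.\<close>

lemma gain_antimono: "gain (insert_pivot \<sigma> y t) x \<le> gain t x"
  unfolding gain_def newly_contradicts_def same_leaf_insert_pivot
  by (intro E_mono) (auto simp: of_bool_def)

lemma violation_fold_le:
  "violation (fold (insert_pivot \<sigma>) xs t) \<le> violation t + (\<Sum>x\<leftarrow>xs. gain t x)"
proof (induction xs arbitrary: t)
  case (Cons x xs)
  have "(\<Sum>y\<leftarrow>xs. gain (insert_pivot \<sigma> x t) y) \<le> (\<Sum>y\<leftarrow>xs. gain t y)"
    by (intro sum_list_mono gain_antimono)
  then show ?case
    using Cons[of "insert_pivot \<sigma> x t"] by (simp add: violation_insert_pivot)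
qed simp

text \<open>An inserted element leaves all leaves, and later insertions only refine them.\<close>

lemma not_same_leaf_fold:
  assumes "u \<in> set xs"
  shows "\<not> same_leaf \<sigma> (fold (insert_pivot \<sigma>) xs t) u v"
proof -
  have mono: "same_leaf \<sigma> t u v" if "same_leaf \<sigma> (fold (insert_pivot \<sigma>) ys t) u v" for ys t
    using that
  proof (induction ys arbitrary: t)
    case (Cons a ys)
    then have "same_leaf \<sigma> (insert_pivot \<sigma> a t) u v" by simp
    then show ?case by (simp add: same_leaf_insert_pivot)
  qed simp
  have "\<not> same_leaf \<sigma> (insert_pivot \<sigma> u t) u v" for t
  proof
    assume *: "same_leaf \<sigma> (insert_pivot \<sigma> u t) u v"
    then have "same_leaf \<sigma> t u u"
      using same_leaf_sym same_leaf_trans unfolding same_leaf_insert_pivot by blast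
    then show False using * unfolding same_leaf_insert_pivot separates_def by blast
  qed
  then show ?thesis using assms mono by (induction xs arbitrary: t) auto
qed

text \<open>By \<open>violated_or_same_leaf\<close>, an uncontradicted disagreement lies inside one
  leaf, and no inserted element lies in a leaf.\<close>

lemma disagreement_cases:
  assumes "e \<in> disagreements \<sigma> (tree_order n \<sigma> (fold (insert_pivot \<sigma>) xs t))"
  shows "contradicts (fold (insert_pivot \<sigma>) xs t) e \<or> e \<subseteq> {1..n} - set xs"
proof -
  let ?t = "fold (insert_pivot \<sigma>) xs t"
  obtain u v where uv: "e = {u, v}" "(u, v) \<in> \<sigma>" "before \<sigma> ?t v u"
    using assms unfolding disagreements_def tree_order_def by auto
  consider "violated \<sigma> ?t u v" | "same_leaf \<sigma> ?t u v"
    using violated_or_same_leaf[OF asym uv(2,3)] by blast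
  then show ?thesis
  proof cases
    case 1
    then show ?thesis using uv unfolding contradicts_def by blast
  next
    case 2
    then have "u \<notin> set xs" "v \<notin> set xs"
      using not_same_leaf_fold same_leaf_sym by blast+
    then show ?thesis using uv(1) range[OF uv(2)] by auto
  qed
qed

text \<open>Of the mass \<epsilon> of disagreements, \<epsilon>/4 may stem from existing violations
  and \<epsilon>/4 from discarded elements, so the gains over \<open>G\<close> sum to at least
  \<epsilon>/2. Elements of \<open>G\<close> have weight at least \<epsilon>/(8n) and gain below
  \<theta>, whence the second term of the minimum. The first term covers the case that
  \<open>B\<close> is heavy.\<close>

lemma drift:
  assumes far: "far_from_total_orderings n \<epsilon> D \<sigma>" and "\<epsilon> > 0" "n > 0" "\<theta> > 0"
    and small: "violation t \<le> \<epsilon> / 4"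
  shows "min (\<epsilon> * \<theta> / 8) (\<epsilon>\<^sup>2 / (16 * real n)) \<le> E (\<lambda>e. min \<theta> (gain t (Min e)))"
proof -
  define L where "L = {x \<in> {1..n}. weight x < \<epsilon> / (8 * real n)}"
  define B where "B = {x \<in> {1..n}. \<theta> \<le> gain t x}"
  define G where "G = {1..n} - (L \<union> B)"
  have sub: "L \<subseteq> {1..n}" "B \<subseteq> {1..n}" "G \<subseteq> {1..n}" by (auto simp: L_def B_def G_def)
  have fin: "finite L" "finite B" "finite G" using sub by (auto intro: finite_subset)
  have part: "(\<Sum>x\<in>S. weight x * min \<theta> (gain t x)) \<le> E (\<lambda>e. min \<theta> (gain t (Min e)))"
    if "S \<subseteq> {1..n}" for S
    unfolding E_Min[where F = "\<lambda>x. min \<theta> (gain t x)"] using that \<open>\<theta> > 0\<close>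
    by (intro sum_mono2) (auto intro!: mult_nonneg_nonneg simp: weight_nonneg gain_nonneg)
  show ?thesis
  proof (cases "\<epsilon> / 8 \<le> (\<Sum>x\<in>B. weight x)")
    case True
    have "\<epsilon> * \<theta> / 8 \<le> (\<Sum>x\<in>B. weight x) * \<theta>"
      using mult_right_mono[OF True, of \<theta>] \<open>\<theta> > 0\<close> by simp
    also have "\<dots> = (\<Sum>x\<in>B. weight x * min \<theta> (gain t x))"
      unfolding sum_distrib_right by (intro sum.cong) (auto simp: B_def)
    also note part[OF sub(2)]
    finally show ?thesis by simp
  next
    case False
    have "(\<Sum>x\<in>L. weight x) \<le> (\<Sum>x\<in>L. \<epsilon> / (8 * real n))"
      by (intro sum_mono) (auto simp: L_def)
    also have "\<dots> \<le> real n * (\<epsilon> / (8 * real n))"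
      unfolding sum_constant using card_mono[OF _ sub(1)] \<open>\<epsilon> > 0\<close> by (intro mult_right_mono) auto
    also have "\<dots> = \<epsilon> / 8" using \<open>n > 0\<close> by simp
    finally have L: "(\<Sum>x\<in>L. weight x) \<le> \<epsilon> / 8" .
    have "E (\<lambda>e. of_bool (Min e \<in> L \<union> B)) = (\<Sum>x\<in>{1..n}. weight x * of_bool (x \<in> L \<union> B))"
      by (rule E_Min)
    also have "\<dots> = (\<Sum>x\<in>L \<union> B. weight x)"
      using sub by (intro sum.mono_neutral_cong_right) auto
    also have "\<dots> \<le> (\<Sum>x\<in>L. weight x) + (\<Sum>x\<in>B. weight x)"
      using fin by (simp add: sum_Un sum_nonneg weight_nonneg)
    finally have H: "E (\<lambda>e. of_bool (Min e \<in> L \<union> B)) \<le> \<epsilon> / 4"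
      using L False by simp
    \<comment> \<open>After inserting all of \<open>G\<close>, an uncontradicted disagreement
      consists of discarded elements only. Sorting merely fixes some order of insertion.\<close>
    define xs where "xs = sorted_list_of_set G"
    define T where "T = fold (insert_pivot \<sigma>) xs t"
    have "\<epsilon> \<le> measure_pmf.prob D (disagreements \<sigma> (tree_order n \<sigma> T))"
      using far total_ordering_tree_order unfolding far_from_total_orderings_def by blast
    also have "\<dots> \<le> E (\<lambda>e. of_bool (contradicts T e) + of_bool (Min e \<in> L \<union> B))"
      unfolding prob_eq_E
    proof (rule E_mono)
      fix e assume e: "e \<in> set_pmf D"
      have "Min e \<in> L \<union> B" if "e \<subseteq> {1..n} - set xs"
        using that sampled_pair(1)[OF e] fin by (auto simp: xs_def G_def)
      then show "of_bool (e \<in> disagreements \<sigma> (tree_order n \<sigma> T))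
          \<le> (of_bool (contradicts T e) + of_bool (Min e \<in> L \<union> B) :: real)"
        using disagreement_cases[of e xs t] unfolding T_def by (auto simp: of_bool_def)
    qed
    also have "\<dots> \<le> violation T + \<epsilon> / 4" using H by (simp add: violation_def)
    also have "violation T \<le> violation t + (\<Sum>x\<in>G. gain t x)"
      using violation_fold_le[of xs t] fin
      by (simp add: T_def xs_def sum_list_distinct_conv_sum_set)
    finally have "\<epsilon> / 2 \<le> (\<Sum>x\<in>G. gain t x)" using small by simp
    then have "\<epsilon> / (8 * real n) * (\<epsilon> / 2) \<le> \<epsilon> / (8 * real n) * (\<Sum>x\<in>G. gain t x)"
      using \<open>\<epsilon> > 0\<close> by (intro mult_left_mono) auto
    also have "\<dots> \<le> (\<Sum>x\<in>G. weight x * min \<theta> (gain t x))"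
      unfolding sum_distrib_left
    proof (rule sum_mono)
      fix x assume "x \<in> G"
      then have "\<epsilon> / (8 * real n) \<le> weight x" "min \<theta> (gain t x) = gain t x"
        by (auto simp: G_def L_def B_def)
      then show "\<epsilon> / (8 * real n) * gain t x \<le> weight x * min \<theta> (gain t x)"
        by (simp only: mult_right_mono gain_nonneg)
    qed
    also note part[OF sub(3)]
    finally show ?thesis by (simp add: power2_eq_square)
  qed
qed

section \<open>Growth of the violation under random pivots\<close>

primrec random_tree :: "nat \<Rightarrow> nat tree pmf" where
  "random_tree 0 = return_pmf Leaf"
| "random_tree (Suc m) =
    bind_pmf (random_tree m) (\<lambda>t. map_pmf (\<lambda>e. insert_pivot \<sigma> (Min e) t) D)"

abbreviation R :: "nat \<Rightarrow> (nat tree \<Rightarrow> real) \<Rightarrow> real" where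
  "R m \<equiv> measure_pmf.expectation (random_tree m)"

lemma finite_random_tree: "finite (set_pmf (random_tree m))"
  by (induction m) (auto simp: finite_support)

lemma integrable_random_tree [simp]: "integrable (measure_pmf (random_tree m)) (F :: _ \<Rightarrow> real)"
  by (rule integrable_measure_pmf_finite[OF finite_random_tree])

lemma R_0: "R 0 F = F Leaf"
  by simp

lemma R_Suc: "R (Suc m) F = R m (\<lambda>t. E (\<lambda>e. F (insert_pivot \<sigma> (Min e) t)))"
  by (simp add: expectation_bind_finite finite_random_tree finite_support)

lemma R_mono: "(\<And>t. F t \<le> F' t) \<Longrightarrow> R m F \<le> R m F'"
  by (intro integral_mono) auto

declare random_tree.simps [simp del]

text \<open>Truncating the violation at \<open>2 * \<theta>\<close> keeps it bounded while \<open>drift\<close> makes its expectation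
  grow in every round in which it is below \<open>\<theta>\<close>; no concentration is needed.\<close>

lemma small_violation_unlikely:
  assumes far: "far_from_total_orderings n \<epsilon> D \<sigma>" and "\<epsilon> > 0" "n > 0" "\<theta> > 0" "\<theta> \<le> \<epsilon> / 4"
    and p: "p = min (\<epsilon> * \<theta> / 8) (\<epsilon>\<^sup>2 / (16 * real n))"
  shows "real m * p * R m (\<lambda>t. of_bool (violation t < \<theta>)) \<le> 2 * \<theta>"
proof -
  define H where "H m = R m (\<lambda>t. min (2 * \<theta>) (violation t))" for m
  define P where "P m = R m (\<lambda>t. of_bool (violation t < \<theta>))" for m
  have "p \<ge> 0" using p assms by auto
  \<comment> \<open>Below \<theta>, adding a gain capped at \<theta> stays below 2\<theta>, so the
    outer truncation loses nothing of the drift.\<close>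
  have step: "min (2 * \<theta>) (violation t) + p * of_bool (violation t < \<theta>)
      \<le> E (\<lambda>e. min (2 * \<theta>) (violation (insert_pivot \<sigma> (Min e) t)))" for t
  proof (cases "violation t < \<theta>")
    case True
    have "p \<le> E (\<lambda>e. min \<theta> (gain t (Min e)))"
      using drift[OF far \<open>\<epsilon> > 0\<close> \<open>n > 0\<close> \<open>\<theta> > 0\<close>, of t] True assms by auto
    then have "violation t + p \<le> E (\<lambda>e. violation t + min \<theta> (gain t (Min e)))"
      by simp
    also have "\<dots> \<le> E (\<lambda>e. min (2 * \<theta>) (violation (insert_pivot \<sigma> (Min e) t)))"
      using True by (intro E_mono) (auto simp: violation_insert_pivot)
    finally show ?thesis using True \<open>\<theta> > 0\<close> by simp
  next
    case False
    have "E (\<lambda>_. min (2 * \<theta>) (violation t))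
        \<le> E (\<lambda>e. min (2 * \<theta>) (violation (insert_pivot \<sigma> (Min e) t)))"
      using gain_nonneg[of t] by (intro E_mono min.mono) (auto simp: violation_insert_pivot)
    then show ?thesis using False by simp
  qed
  have HP: "H m + p * P m \<le> H (Suc m)" for m
  proof -
    have "H m + p * P m
        = R m (\<lambda>t. min (2 * \<theta>) (violation t) + p * of_bool (violation t < \<theta>))"
      by (simp add: H_def P_def)
    also have "\<dots> \<le> H (Suc m)"
      unfolding H_def R_Suc by (intro R_mono step)
    finally show ?thesis .
  qed
  \<comment> \<open>The violation never decreases, so \<open>P m\<close> is a lower bound for the
    probabilities of all earlier rounds.\<close>
  have P: "P (Suc m) \<le> P m" for m
  proof -
    have "E (\<lambda>e. of_bool (violation (insert_pivot \<sigma> (Min e) t) < \<theta>))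
        \<le> E (\<lambda>_. of_bool (violation t < \<theta>))" for t
      using gain_nonneg[of t]
      by (intro E_mono) (auto simp: violation_insert_pivot of_bool_def intro: order.strict_trans1[rotated])
    then show ?thesis unfolding P_def R_Suc by (intro R_mono) simp
  qed
  have "real m * p * P m \<le> H m"
  proof (induction m)
    case 0
    then show ?case using violation_nonneg \<open>\<theta> > 0\<close> by (simp add: H_def R_0)
  next
    case (Suc m)
    have "real (Suc m) * p * P (Suc m) \<le> real (Suc m) * p * P m"
      using P \<open>p \<ge> 0\<close> by (intro mult_left_mono) auto
    also have "\<dots> \<le> H m + p * P m" using Suc by (simp add: algebra_simps)
    finally show ?case using HP[of m] by simp
  qed
  also have "H m \<le> R m (\<lambda>_. 2 * \<theta>)" unfolding H_def by (intro R_mono) simp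
  finally show ?thesis by (simp add: P_def)
qed

section \<open>Expected depth of the random tree\<close>

text \<open>The expected path length grows in each round by the collision probability of two random
  elements, which decays like \<open>3 / m\<close>.\<close>

definition collision :: "nat tree \<Rightarrow> real" where
  "collision t = E (\<lambda>e. E (\<lambda>e'. of_bool (same_leaf \<sigma> t (Min e) (Min e'))))"

definition depth :: "nat tree \<Rightarrow> real" where
  "depth t = E (\<lambda>e. real (path_length \<sigma> t (Min e)))"

lemma collision_sum:
  "collision t = (\<Sum>x\<in>{1..n}. \<Sum>y\<in>{1..n}. weight x * weight y * of_bool (same_leaf \<sigma> t x y))"
proof -
  have "collision t
      = E (\<lambda>e. \<Sum>y\<in>{1..n}. weight y * of_bool (same_leaf \<sigma> t (Min e) y))"
    unfolding collision_def using E_Min[where F = "\<lambda>y. of_bool (same_leaf \<sigma> t (Min _) y)"] by simp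
  also have "\<dots> = (\<Sum>x\<in>{1..n}. weight x * (\<Sum>y\<in>{1..n}. weight y * of_bool (same_leaf \<sigma> t x y)))"
    by (rule E_Min)
  finally show ?thesis by (simp only: sum_distrib_left mult.assoc)
qed

lemma depth_insert_pivot: "E (\<lambda>e. depth (insert_pivot \<sigma> (Min e) t)) = depth t + collision t"
proof -
  have "depth (insert_pivot \<sigma> (Min e) t)
      = depth t + E (\<lambda>e'. of_bool (same_leaf \<sigma> t (Min e) (Min e')))" for e
  proof -
    have "same_leaf \<sigma> t (Min e) x = same_leaf \<sigma> t x (Min e)" for x
      using same_leaf_sym by blast
    then show ?thesis by (simp add: depth_def path_length_insert_pivot)
  qed
  then show ?thesis by (simp add: collision_def)
qed

text \<open>In a transitive triangle the middle element separates the other two, in a cyclic one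
  every element does. If two of the elements coincide, one of them separates by definition.\<close>

lemma exists_separator:
  assumes "x \<in> {1..n}" "y \<in> {1..n}" "z \<in> {1..n}"
  shows "separates \<sigma> x y z \<or> separates \<sigma> y z x \<or> separates \<sigma> z x y"
proof -
  have "(v, u) \<in> \<sigma> \<longleftrightarrow> (u, v) \<notin> \<sigma>" if "u \<in> {1..n}" "v \<in> {1..n}" "u \<noteq> v" for u v
    using total[OF that] asymD[OF asym] by blast
  from this[of x y] this[of y z] this[of x z] show ?thesis
    unfolding separates_def using assms by argo
qed

text \<open>Consider three independent elements, the first being the pivot. The drop is the
  probability that they share a leaf and the first separates the others. By symmetry and
  \<open>exists_separator\<close> this is at least a third of the probability that they share a
  leaf, which is a second moment and so at least the squared collision probability.\<close>

lemma collision_insert_pivot: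
  "E (\<lambda>e. collision (insert_pivot \<sigma> (Min e) t)) \<le> collision t - (collision t)\<^sup>2 / 3"
proof -
  let ?S = "\<lambda>F. \<Sum>x\<in>{1..n}. \<Sum>y\<in>{1..n}. \<Sum>z\<in>{1..n}. weight x * weight y * weight z * F x y z"
  define C :: "nat \<Rightarrow> nat \<Rightarrow> nat \<Rightarrow> real" where
    "C x y z = of_bool (same_leaf \<sigma> t x y \<and> same_leaf \<sigma> t x z)" for x y z
  define W :: "nat \<Rightarrow> nat \<Rightarrow> nat \<Rightarrow> real" where
    "W x y z = of_bool (same_leaf \<sigma> t x y \<and> same_leaf \<sigma> t x z \<and> separates \<sigma> x y z)" for x y z
  have C_rot: "C y z x = C x y z" for x y z
  proof -
    have "same_leaf \<sigma> t y z \<and> same_leaf \<sigma> t y x \<longleftrightarrow> same_leaf \<sigma> t x y \<and> same_leaf \<sigma> t x z"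
      using same_leaf_sym[of \<sigma> t x y] same_leaf_sym[of \<sigma> t y x]
        same_leaf_trans[of \<sigma> t x y z] same_leaf_trans[of \<sigma> t y x z] by blast
    then show ?thesis by (simp add: C_def)
  qed
  have W: "W x y z = C x y z * of_bool (separates \<sigma> x y z)" for x y z
    by (auto simp: W_def C_def)
  \<comment> \<open>The three samples have the same weights, so the triple sum is invariant under
    cyclic relabelling.\<close>
  have rot: "?S (\<lambda>x y z. F y z x) = ?S F" for F :: "nat \<Rightarrow> nat \<Rightarrow> nat \<Rightarrow> real"
  proof -
    have "?S (\<lambda>x y z. F y z x)
        = (\<Sum>y\<in>{1..n}. \<Sum>x\<in>{1..n}. \<Sum>z\<in>{1..n}. weight x * weight y * weight z * F y z x)"
      by (rule sum.swap)
    also have "\<dots> = (\<Sum>y\<in>{1..n}. \<Sum>z\<in>{1..n}. \<Sum>x\<in>{1..n}. weight x * weight y * weight z * F y z x)"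
      by (intro sum.cong refl sum.swap)
    finally show ?thesis by (simp add: mult_ac)
  qed
  have "?S C \<le> ?S (\<lambda>x y z. W x y z + W y z x + W z x y)"
  proof (intro sum_mono mult_left_mono)
    fix x y z assume "x \<in> {1..n}" "y \<in> {1..n}" "z \<in> {1..n}"
    then have "1 \<le> (of_bool (separates \<sigma> x y z) + of_bool (separates \<sigma> y z x)
        + of_bool (separates \<sigma> z x y) :: real)"
      using exists_separator[of x y z] by auto
    then have "C x y z * 1 \<le> C x y z * (of_bool (separates \<sigma> x y z)
        + of_bool (separates \<sigma> y z x) + of_bool (separates \<sigma> z x y))"
      by (intro mult_left_mono) (auto simp: C_def)
    also have "\<dots> = W x y z + W y z x + W z x y"
      using C_rot[of x y z] C_rot[of z x y] by (simp add: W algebra_simps)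
    finally show "C x y z \<le> W x y z + W y z x + W z x y" by simp
  qed (simp add: weight_nonneg)
  also have "\<dots> = ?S W + ?S (\<lambda>x y z. W y z x) + ?S (\<lambda>x y z. W z x y)"
    by (simp only: distrib_left sum.distrib)
  also have "\<dots> = 3 * ?S W"
    using rot[of W] rot[of "\<lambda>x y z. W y z x"] by simp
  finally have CW: "?S C \<le> 3 * ?S W" .
  define a where "a x = (\<Sum>y\<in>{1..n}. weight y * of_bool (same_leaf \<sigma> t x y))" for x
  have coll: "collision t = (\<Sum>x\<in>{1..n}. weight x * a x)"
    unfolding collision_sum a_def by (simp only: sum_distrib_left mult.assoc)
  have "?S C = (\<Sum>x\<in>{1..n}. weight x * (a x)\<^sup>2)"
  proof (rule sum.cong[OF refl])
    fix x
    have "(a x)\<^sup>2 = (\<Sum>y\<in>{1..n}. \<Sum>z\<in>{1..n}. weight y * weight z * C x y z)"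
      unfolding a_def power2_eq_square sum_product
      by (intro sum.cong refl) (auto simp: C_def)
    then show "(\<Sum>y\<in>{1..n}. \<Sum>z\<in>{1..n}. weight x * weight y * weight z * C x y z)
        = weight x * (a x)\<^sup>2"
      by (simp add: sum_distrib_left mult.assoc)
  qed
  \<comment> \<open>Variance identity: \<open>a x\<close> is the mass of the leaf of
    \<open>x\<close>, and its mean is \<open>collision t\<close>.\<close>
  moreover have "(\<Sum>x\<in>{1..n}. weight x * (a x)\<^sup>2) - (collision t)\<^sup>2
      = (\<Sum>x\<in>{1..n}. weight x * (a x - collision t)\<^sup>2)"
  proof -
    have "(\<Sum>x\<in>{1..n}. weight x * (a x - collision t)\<^sup>2)
      = (\<Sum>x\<in>{1..n}. weight x * (a x)\<^sup>2 - 2 * collision t * (weight x * a x)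
          + weight x * (collision t)\<^sup>2)"
      by (intro sum.cong refl) (simp add: power2_eq_square algebra_simps)
    also have "\<dots> = (\<Sum>x\<in>{1..n}. weight x * (a x)\<^sup>2) - 2 * collision t * (\<Sum>x\<in>{1..n}. weight x * a x)
          + (\<Sum>x\<in>{1..n}. weight x) * (collision t)\<^sup>2"
      by (simp only: sum.distrib sum_subtractf sum_distrib_left sum_distrib_right)
    finally show ?thesis unfolding sum_weight coll[symmetric] by (simp add: power2_eq_square)
  qed
  moreover have "0 \<le> (\<Sum>x\<in>{1..n}. weight x * (a x - collision t)\<^sup>2)"
    by (intro sum_nonneg mult_nonneg_nonneg weight_nonneg) simp
  ultimately have "(collision t)\<^sup>2 \<le> 3 * ?S W" using CW by linarith
  moreover have "E (\<lambda>e. collision (insert_pivot \<sigma> (Min e) t)) = collision t - ?S W"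
  proof -
    have "collision (insert_pivot \<sigma> x t)
        = collision t - (\<Sum>y\<in>{1..n}. \<Sum>z\<in>{1..n}. weight y * weight z * W x y z)" for x
    proof -
      have "of_bool (same_leaf \<sigma> (insert_pivot \<sigma> x t) y z)
          = of_bool (same_leaf \<sigma> t y z) - W x y z" for y z
      proof -
        have "same_leaf \<sigma> t y z \<and> same_leaf \<sigma> t y x \<longleftrightarrow> same_leaf \<sigma> t x y \<and> same_leaf \<sigma> t x z"
          using same_leaf_sym[of \<sigma> t x y] same_leaf_sym[of \<sigma> t y x]
            same_leaf_trans[of \<sigma> t x y z] same_leaf_trans[of \<sigma> t y x z] by blast
        then show ?thesis unfolding same_leaf_insert_pivot W_def by auto
      qed
      then show ?thesis
        by (simp add: collision_sum right_diff_distrib sum_subtractf)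
    qed
    then have "E (\<lambda>e. collision (insert_pivot \<sigma> (Min e) t))
        = (\<Sum>x\<in>{1..n}. weight x * (collision t
            - (\<Sum>y\<in>{1..n}. \<Sum>z\<in>{1..n}. weight y * weight z * W x y z)))"
      using E_Min[of "\<lambda>x. collision (insert_pivot \<sigma> x t)"] by simp
    also have "\<dots> = (\<Sum>x\<in>{1..n}. weight x) * collision t - ?S W"
      by (simp add: right_diff_distrib sum_subtractf sum_distrib_right sum_distrib_left mult.assoc)
    finally show ?thesis unfolding sum_weight by simp
  qed
  ultimately show ?thesis by simp
qed

text \<open>With Jensen's inequality, averaging turns the drop into the recursion c' \<le> c -
  c^2/3, and 3/(m + 3) is a supersolution that starts at 1.\<close>

lemma collision_random_tree: "R m collision \<le> 3 / (real m + 3)"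
proof (induction m)
  case 0
  have "collision Leaf = 1" by (simp add: collision_def)
  then show ?case by (simp add: R_0)
next
  case (Suc m)
  let ?c = "R m collision"
  have "R (Suc m) collision \<le> R m (\<lambda>t. collision t - (collision t)\<^sup>2 / 3)"
    unfolding R_Suc by (intro R_mono collision_insert_pivot)
  also have "\<dots> = ?c - R m (\<lambda>t. (collision t)\<^sup>2) / 3" by simp
  finally have *: "R (Suc m) collision \<le> ?c - R m (\<lambda>t. (collision t)\<^sup>2) / 3" .
  have "?c\<^sup>2 \<le> R m (\<lambda>t. (collision t)\<^sup>2)"
  proof -
    have "0 \<le> R m (\<lambda>t. (collision t - ?c)\<^sup>2)" by (intro integral_nonneg_AE) simp
    also have "\<dots> = R m (\<lambda>t. (collision t)\<^sup>2 - 2 * ?c * collision t + ?c\<^sup>2)"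
      by (simp add: power2_eq_square algebra_simps)
    also have "\<dots> = R m (\<lambda>t. (collision t)\<^sup>2) - ?c\<^sup>2"
      by (simp add: power2_eq_square)
    finally show ?thesis by simp
  qed
  with * have "R (Suc m) collision \<le> ?c - ?c\<^sup>2 / 3" by linarith
  \<comment> \<open>The map x - x^2/3 is increasing below 3/2, and 3/(m + 3) is at most 1, so the
    induction hypothesis can be inserted.\<close>
  moreover have "?c - ?c\<^sup>2 / 3 \<le> 3 / (real m + 3) - (3 / (real m + 3))\<^sup>2 / 3"
  proof -
    define d where "d = 3 / (real m + 3)"
    have "d \<le> 1" by (simp add: d_def)
    have "0 \<le> (d - ?c) * (1 - (d + ?c) / 3)"
      using Suc \<open>d \<le> 1\<close> by (intro mult_nonneg_nonneg) (auto simp: d_def[symmetric])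
    also have "\<dots> = (d - d\<^sup>2 / 3) - (?c - ?c\<^sup>2 / 3)"
      by (simp add: power2_eq_square field_simps)
    finally show ?thesis unfolding d_def[symmetric] by simp
  qed
  moreover have "3 / (real m + 3) - (3 / (real m + 3))\<^sup>2 / 3 \<le> 3 / (real (Suc m) + 3)"
  proof -
    define y where "y = real m + 3"
    have y: "y > 0" "real (Suc m) + 3 = y + 1" by (simp_all add: y_def)
    have "3 / (y + 1) - (3 / y - (3 / y)\<^sup>2 / 3) = 3 / (y\<^sup>2 * (y + 1))"
      using y(1) by (simp add: field_simps power2_eq_square add_eq_0_iff)
    also have "\<dots> \<ge> 0" using y(1) by simp
    finally show ?thesis unfolding y(2) y_def[symmetric] by simp
  qed
  ultimately show ?case by (meson order_trans)
qed

text \<open>The collision bounds add up to a harmonic sum, which is compared with the logarithm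
  through \<open>ln x \<le> x - 1\<close>.\<close>

lemma depth_random_tree: "R m depth \<le> 3 * ln (real m + 2)"
proof (induction m)
  case 0
  then show ?case by (simp add: R_0 depth_def)
next
  case (Suc m)
  have "ln ((real m + 2) / (real m + 3)) \<le> (real m + 2) / (real m + 3) - 1"
    by (rule ln_le_minus_one) simp
  then have "1 / (real m + 3) \<le> ln (real m + 3) - ln (real m + 2)"
    by (simp add: ln_div field_simps)
  moreover have "R (Suc m) depth = R m depth + R m collision"
    unfolding R_Suc depth_insert_pivot by simp
  ultimately show ?case
    using Suc collision_random_tree[of m] by (simp add: add.commute)
qed

end

section \<open>Analysis of the tester\<close>

text \<open>Runs that are cut off accept, so truncation cannot hurt completeness.\<close>

lemma acceptance_le_truncate:
  assumes fin: "finite (set_pmf D)"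
  shows "acceptance \<sigma> D s \<le> acceptance \<sigma> D (truncate s q)"
proof (induction s arbitrary: q)
  case (Query u v k)
  then show ?case by (cases q) (auto simp: acceptance_le_1)
next
  case (Sample k)
  show ?case
  proof (cases q)
    case 0
    have "acceptance \<sigma> D (Sample k) \<le> 1" by (rule acceptance_le_1)
    then show ?thesis using 0 by simp
  next
    case (Suc r)
    then show ?thesis using Sample.IH[OF rangeI]
      by (auto intro!: integral_mono integrable_measure_pmf_finite[OF fin])
  qed
qed simp

text \<open>A violating pivot \<open>w\<close> has \<open>(v, w) \<in> \<sigma>\<close>;
  transitivity then forces \<open>(u, w) \<in> \<sigma>\<close>, so \<open>w\<close> does not part
  the pair.\<close>

lemma not_violated_if_trans:
  assumes "trans \<sigma>" "(u, v) \<in> \<sigma>"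
  shows "\<not> violated \<sigma> t u v"
  using assms(2) by (induction t) (auto split: if_splits dest: transD[OF assms(1)])

context testing_instance begin

lemma contradicts_iff:
  assumes "e \<in> set_pmf D"
  shows "contradicts t e \<longleftrightarrow>
    violated \<sigma> t (if (Min e, Max e) \<in> \<sigma> then Min e else Max e)
      (if (Min e, Max e) \<in> \<sigma> then Max e else Min e)"
proof -
  note e = sampled_pair[OF assms]
  define a b where "a = Min e" and "b = Max e"
  have "e = {a, b}" "a \<noteq> b" using e by (auto simp: a_def b_def)
  moreover have "(b, a) \<in> \<sigma> \<longleftrightarrow> (a, b) \<notin> \<sigma>"
    using total[of a b] e asymD[OF asym] by (auto simp: a_def b_def)
  ultimately show ?thesis
    unfolding contradicts_def a_def[symmetric] b_def[symmetric]
    by (auto simp: doubleton_eq_iff)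
qed

lemma acceptance_checks: "acceptance \<sigma> D (checks s t) = (1 - violation t) ^ s"
proof (induction s)
  case (Suc s)
  have "acceptance \<sigma> D (checks (Suc s) t)
      = E (\<lambda>e. (1 - of_bool (contradicts t e)) * acceptance \<sigma> D (checks s t))"
    unfolding checks.simps acceptance.simps acceptance_check
    by (intro E_cong) (simp only: contradicts_iff[symmetric], simp)
  also have "\<dots> = (1 - violation t) * acceptance \<sigma> D (checks s t)"
    by (simp add: violation_def)
  finally show ?case using Suc by simp
qed simp

text \<open>Each round costs a sample, an orienting query and two queries per pivot met.\<close>

lemma expected_queries_checks:
  "expected_queries \<sigma> D (checks s t) \<le> real s * (2 + 2 * depth t)"
proof (induction s)
  case (Suc s)
  define k where "k b = (if b then Output False else checks s t)" for b
  have k: "expected_queries \<sigma> D (k b) \<le> expected_queries \<sigma> D (checks s t)" for b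
    by (simp add: k_def expected_queries_nonneg)
  have "expected_queries \<sigma> D (checks (Suc s) t) \<le> 1 +
      E (\<lambda>e. 1 + (2 * real (path_length \<sigma> t (Min e)) + expected_queries \<sigma> D (checks s t)))"
  proof -
    have "expected_queries \<sigma> D (check (if a then Min e else Max e) (if a then Max e else Min e) t k)
        \<le> 2 * real (path_length \<sigma> t (Min e)) + expected_queries \<sigma> D (checks s t)" for a e
      \<comment> \<open>For either orientation the path of the smaller endpoint is used, since its
        mean length is \<open>depth t\<close>.\<close>
      using expected_queries_check(1)[of \<sigma> D "Min e" "Max e" t k]
        expected_queries_check(2)[of \<sigma> D "Max e" "Min e" t k]
        k[of "violated \<sigma> t (Min e) (Max e)"] k[of "violated \<sigma> t (Max e) (Min e)"]
      by (cases a) auto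
    then show ?thesis
      unfolding checks.simps expected_queries.simps k_def[symmetric]
      by (intro add_left_mono E_mono) blast
  qed
  also have "\<dots> = 2 + 2 * depth t + expected_queries \<sigma> D (checks s t)"
    by (simp add: depth_def)
  finally show ?case using Suc by (simp add: algebra_simps)
qed simp

text \<open>Stated for a start with \<open>i\<close> random pivots, so that the induction can move
  one pivot at a time from the strategy into the random tree.\<close>

lemma acceptance_tree_tester:
  "R i (\<lambda>t. acceptance \<sigma> D (tree_tester m s t)) = R (i + m) (\<lambda>t. (1 - violation t) ^ s)"
proof (induction m arbitrary: i)
  case (Suc m)
  have "R i (\<lambda>t. acceptance \<sigma> D (tree_tester (Suc m) s t))
      = R (Suc i) (\<lambda>t. acceptance \<sigma> D (tree_tester m s t))"
    unfolding R_Suc by (simp add: acceptance_insertion)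
  then show ?case using Suc[of "Suc i"] by simp
qed (simp add: acceptance_checks)

lemma expected_queries_tree_tester:
  assumes "\<And>j. j \<le> i + m \<Longrightarrow> R j depth \<le> K"
  shows "R i (\<lambda>t. expected_queries \<sigma> D (tree_tester m s t))
    \<le> real m * (1 + K) + real s * (2 + 2 * K)"
  using assms
proof (induction m arbitrary: i)
  case 0
  have "R i (\<lambda>t. expected_queries \<sigma> D (tree_tester 0 s t)) \<le> R i (\<lambda>t. real s * (2 + 2 * depth t))"
    using expected_queries_checks by (intro R_mono) simp
  also have "\<dots> = real s * (2 + 2 * R i depth)" by simp
  also have "\<dots> \<le> real s * (2 + 2 * K)" using 0[of i] by (intro mult_left_mono) auto
  finally show ?case by simp
next
  case (Suc m)
  have "R i (\<lambda>t. expected_queries \<sigma> D (tree_tester (Suc m) s t))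
      \<le> R i (\<lambda>t. 1 + (depth t +
          E (\<lambda>e. expected_queries \<sigma> D (tree_tester m s (insert_pivot \<sigma> (Min e) t)))))"
  proof (rule R_mono)
    fix t
    have "E (\<lambda>e. expected_queries \<sigma> D (insertion (Min e) t (tree_tester m s)))
        \<le> E (\<lambda>e. real (path_length \<sigma> t (Min e))
            + expected_queries \<sigma> D (tree_tester m s (insert_pivot \<sigma> (Min e) t)))"
      by (intro E_mono expected_queries_insertion)
    then show "expected_queries \<sigma> D (tree_tester (Suc m) s t) \<le> 1 + (depth t +
          E (\<lambda>e. expected_queries \<sigma> D (tree_tester m s (insert_pivot \<sigma> (Min e) t))))"
      by (simp add: depth_def)
  qed
  also have "\<dots> = 1 + (R i depth + R (Suc i) (\<lambda>t. expected_queries \<sigma> D (tree_tester m s t)))"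
    unfolding R_Suc by simp
  also have "\<dots> \<le> 1 + (K + (real m * (1 + K) + real s * (2 + 2 * K)))"
    using Suc.IH[of "Suc i"] Suc.prems by (intro add_left_mono add_mono) auto
  finally show ?case by (simp add: algebra_simps)
qed

section \<open>Completeness and soundness of the tester\<close>

lemma tester_complete:
  assumes "total_ordering n \<sigma>"
  shows "acceptance \<sigma> D (truncate (tree_tester m s Leaf) q) = 1"
proof -
  have "trans \<sigma>" using assms by (simp add: total_ordering_iff)
  then have "\<not> contradicts t e" for t e
    using not_violated_if_trans unfolding contradicts_def by blast
  then have "violation t = 0" for t
    by (simp add: violation_def)
  then have "acceptance \<sigma> D (tree_tester m s Leaf) = 1"
    using acceptance_tree_tester[of 0 m s] by (simp add: R_0)
  then show ?thesis
    using acceptance_le_truncate[OF finite_support, of \<sigma> "tree_tester m s Leaf" q]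
      acceptance_le_1[of \<sigma> D "truncate (tree_tester m s Leaf) q"] by simp
qed

text \<open>Three sources of error: the violation stays below \<theta> (at most 1/10), all
  \<open>s\<close> checks miss a violation of at least \<theta> (at most 1/8, as
  \<open>s * \<theta> \<ge> 3\<close>), and truncation (at most 1/10 by Markov). Together they stay
  below 1/3.\<close>

lemma tester_sound:
  assumes far: "far_from_total_orderings n \<epsilon> D \<sigma>" and "\<epsilon> > 0" "n > 0"
    and g: "g = sqrt (real n) / \<epsilon>" "g \<ge> 1"
    and m: "m = nat \<lceil>320 * g\<rceil>" and s: "s = nat \<lceil>12 * g\<rceil>"
    and q: "q = nat \<lfloor>80000 * g * ln (2 + g)\<rfloor>"
  shows "acceptance \<sigma> D (truncate (tree_tester m s Leaf) q) \<le> 1 / 3"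
proof -
  define \<theta> where "\<theta> = 1 / (4 * g)"
  define \<l> where "\<l> = ln (2 + g)"
  have \<theta>: "0 < \<theta>" "\<theta> \<le> 1" using g(2) by (auto simp: \<theta>_def)
  have ineq: "sqrt (real n) \<ge> 1" using \<open>n > 0\<close> by simp
  have \<theta>_eq: "\<theta> = \<epsilon> / (4 * sqrt (real n))" using g(1) by (simp add: \<theta>_def)
  have "\<theta> \<le> \<epsilon> / 4"
    using ineq \<open>\<epsilon> > 0\<close> unfolding \<theta>_eq by (simp add: divide_simps)
  define p where "p = min (\<epsilon> * \<theta> / 8) (\<epsilon>\<^sup>2 / (16 * real n))"
  have mg: "320 * g \<le> real m" "real m \<le> 321 * g" using m g(2) by linarith+
  have sg: "12 * g \<le> real s" "real s \<le> 13 * g" using s g(2) by linarith+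
  have ge: "g * \<epsilon> = sqrt (real n)" using g(1) \<open>\<epsilon> > 0\<close> by simp
  \<comment> \<open>The number of pivots makes \<open>m * p\<close> at least 20\<theta> for either
    term of the minimum \<open>p\<close>. Against the bound 2\<theta> from
    \<open>small_violation_unlikely\<close> this yields 1/10.\<close>
  have "20 * \<theta> \<le> real m * (\<epsilon> * \<theta> / 8)"
  proof -
    have "20 * \<theta> \<le> (40 * (g * \<epsilon>)) * \<theta>"
      using \<theta>(1) unfolding ge by (intro mult_right_mono) (use ineq in linarith)+
    also have "\<dots> = 320 * g * (\<epsilon> * \<theta> / 8)" by simp
    also have "\<dots> \<le> real m * (\<epsilon> * \<theta> / 8)"
      using mg(1) \<open>\<epsilon> > 0\<close> \<theta>(1) by (intro mult_right_mono) auto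
    finally show ?thesis .
  qed
  moreover have "20 * \<theta> \<le> real m * (\<epsilon>\<^sup>2 / (16 * real n))"
  proof -
    have n: "real n = sqrt (real n) * sqrt (real n)" by simp
    have "320 * g * (\<epsilon>\<^sup>2 / (16 * real n)) = 20 * ((g * \<epsilon>) * \<epsilon> / real n)"
      by (simp add: power2_eq_square)
    also have "\<dots> = 20 * (\<epsilon> / sqrt (real n))"
      unfolding ge using ineq by (subst (2) n) (simp add: field_simps)
    also have "\<dots> \<ge> 20 * \<theta>"
      unfolding \<theta>_eq using ineq \<open>\<epsilon> > 0\<close> by (simp add: divide_simps)
    finally have "20 * \<theta> \<le> 320 * g * (\<epsilon>\<^sup>2 / (16 * real n))" .
    also have "\<dots> \<le> real m * (\<epsilon>\<^sup>2 / (16 * real n))"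
      using mg(1) by (intro mult_right_mono) auto
    finally show ?thesis .
  qed
  ultimately have mp: "20 * \<theta> \<le> real m * p" by (simp add: p_def min_def)
  define P where "P = R m (\<lambda>t. of_bool (violation t < \<theta>))"
  have "P \<ge> 0" unfolding P_def by (intro integral_nonneg_AE) simp
  then have "20 * \<theta> * P \<le> real m * p * P" using mp by (intro mult_right_mono)
  also have "\<dots> \<le> 2 * \<theta>"
    unfolding P_def using far \<open>\<epsilon> > 0\<close> \<open>n > 0\<close> \<theta>(1) \<open>\<theta> \<le> \<epsilon> / 4\<close> p_def
    by (intro small_violation_unlikely)
  finally have P: "P \<le> 1 / 10" using \<theta>(1) by simp
  have "(1 - \<theta>) ^ s \<le> exp (- \<theta>) ^ s"
    using \<theta> exp_ge_add_one_self[of "- \<theta>"] by (intro power_mono) auto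
  also have "\<dots> = exp (- (real s * \<theta>))"
    by (simp add: exp_of_nat_mult[symmetric])
  also have "\<dots> \<le> exp (- 3)"
  proof -
    have "3 = 12 * g * \<theta>" using g(2) by (simp add: \<theta>_def)
    also have "\<dots> \<le> real s * \<theta>" using sg(1) \<theta>(1) by (intro mult_right_mono) auto
    finally show ?thesis by simp
  qed
  also have "exp (- 3 :: real) \<le> 1 / 8"
  proof -
    have "(2 :: real) ^ 3 \<le> exp 1 ^ 3"
      using exp_ge_add_one_self[of "1 :: real"] by (intro power_mono) auto
    also have "\<dots> = exp 3" by (simp add: exp_of_nat_mult[symmetric])
    finally show ?thesis by (simp add: exp_minus field_simps)
  qed
  finally have power: "(1 - \<theta>) ^ s \<le> 1 / 8" .
  have "acceptance \<sigma> D (tree_tester m s Leaf) = R m (\<lambda>t. (1 - violation t) ^ s)"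
    using acceptance_tree_tester[of 0 m s] by (simp add: R_0)
  also have "\<dots> \<le> R m (\<lambda>t. of_bool (violation t < \<theta>) + (1 - \<theta>) ^ s)"
  proof (rule R_mono)
    fix t
    show "(1 - violation t) ^ s \<le> of_bool (violation t < \<theta>) + (1 - \<theta>) ^ s"
    proof (cases "violation t < \<theta>")
      case True
      then show ?thesis
        using violation_nonneg[of t] violation_le_1[of t] \<theta> power_le_one[of "1 - violation t" s]
        by (simp add: add_increasing2)
    next
      case False
      then show ?thesis using violation_le_1[of t] by (auto intro: power_mono)
    qed
  qed
  also have "\<dots> = P + (1 - \<theta>) ^ s" by (simp add: P_def)
  finally have acc: "acceptance \<sigma> D (tree_tester m s Leaf) \<le> 1 / 10 + 1 / 8"
    using P power by linarith
  have "ln (exp 1) \<le> ln (3 :: real)" using exp_le by (subst ln_le_cancel_iff) auto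
  then have "1 \<le> ln (3 :: real)" by simp
  moreover have "ln 3 \<le> \<l>" unfolding \<l>_def using g(2) by simp
  ultimately have \<l>: "1 \<le> \<l>" "ln 3 \<le> \<l>" by auto
  \<comment> \<open>The factor 729 absorbs the 321 in the bound on \<open>m\<close>. It costs six
    times \<open>ln 3 \<le> \<l>\<close>, so the depth is at most 3 * 7 = 21 times
    \<open>\<l>\<close>.\<close>
  have "ln (real m + 2) \<le> ln (3 ^ 6 * (2 + g))"
    using mg g(2) by (subst ln_le_cancel_iff) auto
  also have "\<dots> = 6 * ln 3 + \<l>"
    using g(2) ln_realpow[of 3 6] unfolding \<l>_def by (subst ln_mult) simp_all
  finally have lnm: "3 * ln (real m + 2) \<le> 21 * \<l>" using \<l> by simp
  have "R j depth \<le> 21 * \<l>" if "j \<le> m" for j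
  proof -
    have "ln (real j + 2) \<le> ln (real m + 2)" using that by simp
    then show ?thesis using depth_random_tree[of j] lnm by linarith
  qed
  then have "expected_queries \<sigma> D (tree_tester m s Leaf)
      \<le> real m * (1 + 21 * \<l>) + real s * (2 + 2 * (21 * \<l>))"
    using expected_queries_tree_tester[of 0 m "21 * \<l>" s] by (simp add: R_0)
  also have "\<dots> \<le> 321 * g * (22 * \<l>) + 13 * g * (44 * \<l>)"
    using mg sg \<l>(1) g(2) by (intro add_mono mult_mono) auto
  finally have queries: "expected_queries \<sigma> D (tree_tester m s Leaf) \<le> 7634 * (g * \<l>)" by (simp add: mult_ac)
  have gl: "1 \<le> g * \<l>" using \<l>(1) g(2) by (metis mult_mono' mult_1 zero_le_one)
  \<comment> \<open>The floor loses at most 1, which \<open>g * \<l> \<ge> 1\<close> absorbs. The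
    constant is ten times 7634, so Markov gives 1/10.\<close>
  have q': "76340 * (g * \<l>) \<le> real q"
    using gl unfolding q \<l>_def[symmetric] by (simp add: mult.assoc) linarith
  have "expected_queries \<sigma> D (tree_tester m s Leaf) / real q \<le> 1 / 10"
    using queries q' gl by (simp add: divide_simps)
  moreover have "acceptance \<sigma> D (truncate (tree_tester m s Leaf) q)
      \<le> acceptance \<sigma> D (tree_tester m s Leaf)
        + (expected_queries \<sigma> D (tree_tester m s Leaf) + (real q - real q)) / real q"
    using q' gl by (intro acceptance_truncate_le[OF finite_support]) auto
  ultimately show ?thesis using acc by simp
qed

end

text \<open>For \<epsilon> > 1 no instance is far, because probabilities do not exceed 1, so
  constant acceptance is correct. Otherwise \<open>g \<ge> 1\<close> whenever n > 0, as the analysis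
  requires.\<close>

definition tester :: "nat \<Rightarrow> real \<Rightarrow> strategy" where
  "tester n \<epsilon> = (let g = sqrt (real n) / \<epsilon> in
     if \<epsilon> > 1 then Output True
     else truncate (tree_tester (nat \<lceil>320 * g\<rceil>) (nat \<lceil>12 * g\<rceil>) Leaf)
       (nat \<lfloor>80000 * g * ln (2 + g)\<rfloor>))"

lemma execute_return [simp]: "execute (return_pmf s) \<sigma> D = run \<sigma> D s"
  by (simp add: execute_def bind_return_pmf)

lemma pair_distribution_pos: "pair_distribution n D \<Longrightarrow> n > 0"
  using set_pmf_not_empty[of D] unfolding pair_distribution_def
  by (cases n) (auto simp: nsets_eq_empty)

lemma distribution_free_tester_tester:
  assumes "\<epsilon> > 0"
  shows "distribution_free_tester n \<epsilon> (return_pmf (tester n \<epsilon>))"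
  unfolding distribution_free_tester_def execute_return prob_reject prob_run_accept
proof (intro allI impI conjI; elim conjE)
  fix \<sigma> D
  assume cf: "comparison_function n \<sigma>" and pd: "pair_distribution n D"
  then interpret testing_instance n \<sigma> D by unfold_locales
  show "2 / 3 \<le> acceptance \<sigma> D (tester n \<epsilon>)" if "total_ordering n \<sigma>"
    using tester_complete[OF that] by (simp add: tester_def Let_def)
  show "2 / 3 \<le> 1 - acceptance \<sigma> D (tester n \<epsilon>)" if far: "far_from_total_orderings n \<epsilon> D \<sigma>"
  proof -
    have "\<epsilon> \<le> measure_pmf.prob D (disagreements \<sigma> (tree_order n \<sigma> Leaf))"
      using far total_ordering_tree_order unfolding far_from_total_orderings_def by blast
    also have "\<dots> \<le> 1" by simp
    finally have "\<epsilon> \<le> 1" .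
    have "n > 0" using pd by (rule pair_distribution_pos)
    then have "1 \<le> sqrt (real n)" by simp
    then have "\<epsilon> \<le> sqrt (real n)" using \<open>\<epsilon> \<le> 1\<close> by linarith
    then have "1 \<le> sqrt (real n) / \<epsilon>" using \<open>\<epsilon> > 0\<close> by simp
    from tester_sound[OF far \<open>\<epsilon> > 0\<close> \<open>n > 0\<close> refl this refl refl refl]
    show ?thesis using \<open>\<epsilon> \<le> 1\<close> by (simp add: tester_def Let_def)
  qed
qed

lemma makes_at_most_queries_tester:
  assumes "\<epsilon> > 0"
  shows "makes_at_most_queries n (return_pmf (tester n \<epsilon>)) (soft_bound 80000 1 (sqrt (real n) / \<epsilon>))"
proof -
  define g where "g = sqrt (real n) / \<epsilon>"
  have "g \<ge> 0" using assms by (simp add: g_def)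
  then have pos: "0 \<le> 80000 * g * ln (2 + g)" by simp
  have "real r \<le> 80000 * g * ln (2 + g)" if "(b, r) \<in> set_pmf (run \<sigma> D (tester n \<epsilon>))" for b r \<sigma> D
  proof (cases "\<epsilon> > 1")
    case True
    then show ?thesis using that pos by (simp add: tester_def Let_def)
  next
    case False
    then have "r \<le> nat \<lfloor>80000 * g * ln (2 + g)\<rfloor>"
      using that queries_truncate unfolding tester_def Let_def g_def[symmetric] by auto
    then show ?thesis using pos by linarith
  qed
  then show ?thesis
    unfolding makes_at_most_queries_def soft_bound_def execute_return g_def[symmetric]
    by (auto simp: mult.assoc)
qed

section \<open>Hidden triples\<close>

text \<open>A permutation \<open>\<pi>\<close> sends elements to positions, and the triples are the positions
  \<open>{3b, 3b + 1, 3b + 2}\<close> with \<open>b \<ge> 1\<close>.  The incomplete triples at both ends of \<open>[n]\<close> never contain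
  positions of residue 0 and of residue 2, hence they are ordered in the same way in both cases.\<close>

definition triple_less :: "bool \<Rightarrow> nat \<Rightarrow> nat \<Rightarrow> bool" where
  "triple_less c p q \<longleftrightarrow>
     (if c \<and> p div 3 = q div 3 then (p mod 3, q mod 3) \<in> {(0, 1), (1, 2), (2, 0)} else p < q)"

definition hidden_order :: "nat \<Rightarrow> bool \<Rightarrow> (nat \<Rightarrow> nat) \<Rightarrow> (nat \<times> nat) set" where
  "hidden_order n c \<pi> = {(u, v). u \<in> {1..n} \<and> v \<in> {1..n} \<and> triple_less c (\<pi> u) (\<pi> v)}"

text \<open>The upper end is the largest b with 3b + 2 \<le> n; block 0 is left out because position
  0 does not exist in [n].\<close>

definition triples :: "nat \<Rightarrow> nat set" where
  "triples n = {1..(n - 2) div 3}"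

definition hidden_pair :: "(nat \<Rightarrow> nat) \<Rightarrow> nat \<times> nat \<Rightarrow> nat set" where
  "hidden_pair \<pi> = (\<lambda>(b, i). {inv \<pi> (3 * b + i), inv \<pi> (3 * b + (i + 1) mod 3)})"

text \<open>The flag \<open>c\<close> does not enter, so both cases have the same law of samples and
  differ only in the answers to queries.\<close>

definition hidden_pairs :: "nat \<Rightarrow> (nat \<Rightarrow> nat) \<Rightarrow> nat set pmf" where
  "hidden_pairs n \<pi> = map_pmf (hidden_pair \<pi>) (pmf_of_set (triples n \<times> {..<3}))"

lemma triple_position:
  assumes "b \<in> triples n" "i < 3"
  shows "3 * b + i \<in> {1..n}"
proof -
  have "1 \<le> b" "b \<le> (n - 2) div 3" using assms by (auto simp: triples_def)
  then show ?thesis using assms(2) by auto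
qed

lemma triple_less_asym:
  assumes "triple_less c p q"
  shows "\<not> triple_less c q p"
proof -
  have *: "(b, a) \<notin> {(0, 1), (1, 2), (2, 0)}" if "(a, b) \<in> {(0, 1), (1, 2), (2, 0)}" for a b :: nat
    using that by (metis insert_iff empty_iff prod.inject one_neq_zero zero_neq_numeral
        numeral_eq_one_iff semiring_norm(85))
  show ?thesis
  proof (cases "c \<and> p div 3 = q div 3")
    case True
    then have True': "c \<and> q div 3 = p div 3" by metis
    have "(p mod 3, q mod 3) \<in> {(0, 1), (1, 2), (2, 0)}"
      using assms unfolding triple_less_def if_P[OF True] .
    from *[OF this] show ?thesis unfolding triple_less_def if_P[OF True'] .
  next
    case False
    then have False': "\<not> (c \<and> q div 3 = p div 3)" by metis
    show ?thesis using assms unfolding triple_less_def if_not_P[OF False] if_not_P[OF False'] by simp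
  qed
qed

lemma triple_less_total:
  assumes "p \<noteq> q"
  shows "triple_less c p q \<or> triple_less c q p"
proof -
  have *: "(a, b) \<in> {(0, 1), (1, 2), (2, 0)} \<or> (b, a) \<in> {(0, 1), (1, 2), (2, 0)}"
    if "a \<noteq> b" "a < 3" "b < 3" for a b :: nat
  proof -
    have "a = 0 \<or> a = 1 \<or> a = 2" "b = 0 \<or> b = 1 \<or> b = 2" using that by linarith+
    then show ?thesis using that(1) by auto
  qed
  show ?thesis
  proof (cases "c \<and> p div 3 = q div 3")
    case True
    then have "p mod 3 \<noteq> q mod 3" using assms by (metis div_mult_mod_eq)
    then show ?thesis
      using True *[of "p mod 3" "q mod 3"] unfolding triple_less_def by simp
  next
    case False
    then have "\<not> (c \<and> q div 3 = p div 3)" by metis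
    then show ?thesis using False assms unfolding triple_less_def if_not_P[OF False]
      by (simp only: if_False linorder_neq_iff)
  qed
qed

text \<open>Makes the flag \<open>c\<close> irrelevant between different triples: there only the
  block numbers count.\<close>

lemma triple_less_other: "p div 3 \<noteq> q div 3 \<Longrightarrow> triple_less c p q \<longleftrightarrow> p div 3 < q div 3"
proof -
  assume ne: "p div 3 \<noteq> q div 3"
  have "p < q \<longleftrightarrow> p div 3 < q div 3"
    using ne div_le_mono[of p q 3] div_le_mono[of q p 3] by linarith
  then show "triple_less c p q \<longleftrightarrow> p div 3 < q div 3"
    using ne by (simp only: triple_less_def simp_thms if_False)
qed

section \<open>Validity of the hidden instances\<close>

lemma comparison_hidden_order:
  assumes "\<pi> permutes {1..n}"
  shows "comparison_function n (hidden_order n c \<pi>)"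
  unfolding comparison_function_def
proof (intro conjI)
  show "total_on {1..n} (hidden_order n c \<pi>)"
  proof (rule total_onI)
    fix u v assume "u \<in> {1..n}" "v \<in> {1..n}" "u \<noteq> v"
    moreover have "\<pi> u \<noteq> \<pi> v" using permutes_inj[OF assms] \<open>u \<noteq> v\<close> by (simp add: inj_eq)
    ultimately show "(u, v) \<in> hidden_order n c \<pi> \<or> (v, u) \<in> hidden_order n c \<pi>"
      using triple_less_total[of "\<pi> u" "\<pi> v" c] by (simp add: hidden_order_def)
  qed
  show "asym (hidden_order n c \<pi>)"
    by (rule asymI) (auto simp: hidden_order_def dest: triple_less_asym)
qed (auto simp: hidden_order_def)

lemma total_hidden_order:
  assumes "\<pi> permutes {1..n}"
  shows "total_ordering n (hidden_order n False \<pi>)"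
proof -
  have "trans (hidden_order n False \<pi>)"
    by (auto simp: hidden_order_def triple_less_def trans_def)
  then show ?thesis using comparison_hidden_order[OF assms] by (simp add: total_ordering_iff)
qed

lemma triples_finite_nonempty:
  assumes "n \<ge> 16"
  shows "finite (triples n)" "triples n \<noteq> {}" "real n \<le> 4 * real (card (triples n))"
proof -
  have "n \<le> 4 * ((n - 2) div 3)" using assms by linarith
  then show "real n \<le> 4 * real (card (triples n))" by (simp add: triples_def)
qed (use assms in \<open>auto simp: triples_def\<close>)

lemma pair_distribution_hidden_pairs:
  assumes "\<pi> permutes {1..n}" "n \<ge> 16"
  shows "pair_distribution n (hidden_pairs n \<pi>)"
proof -
  note fin = triples_finite_nonempty[OF assms(2)]
  have *: "hidden_pair \<pi> (b, i) \<in> nsets {1..n} 2" if "b \<in> triples n" "i < 3" for b i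
  proof -
    have p: "3 * b + i \<in> {1..n}" "3 * b + (i + 1) mod 3 \<in> {1..n}"
      using triple_position[OF that] triple_position[OF that(1), of "(i + 1) mod 3"] by simp_all
    have ne: "3 * b + i \<noteq> 3 * b + (i + 1) mod 3" using that(2) by presburger
    have "inv \<pi> (3 * b + i) \<in> {1..n}" "inv \<pi> (3 * b + (i + 1) mod 3) \<in> {1..n}"
      using p permutes_in_image[OF permutes_inv[OF assms(1)]] by blast+
    moreover have "inv \<pi> (3 * b + i) \<noteq> inv \<pi> (3 * b + (i + 1) mod 3)"
      using ne permutes_inj[OF permutes_inv[OF assms(1)]] by (metis injD)
    ultimately show ?thesis unfolding hidden_pair_def nsets_2_eq prod.case by blast
  qed
  have "set_pmf (pmf_of_set (triples n \<times> {..<3})) = triples n \<times> {..<3 :: nat}"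
    using fin by (intro set_pmf_of_set) (auto simp: lessThan_empty_iff)
  then show ?thesis
    unfolding pair_distribution_def hidden_pairs_def using * by auto
qed

text \<open>Agreeing with all three pairs of a cyclic triple would be a cycle, so a total ordering
  reverses at least one of them. The three pairs are equally likely, which gives mass at least
  1/3.\<close>

lemma far_hidden_order:
  assumes perm: "\<pi> permutes {1..n}" and "n \<ge> 16" "\<epsilon> \<le> 1 / 3"
  shows "far_from_total_orderings n \<epsilon> (hidden_pairs n \<pi>) (hidden_order n True \<pi>)"
  unfolding far_from_total_orderings_def
proof (intro allI impI)
  fix \<tau> assume \<tau>: "total_ordering n \<tau>"
  note fin = triples_finite_nonempty[OF assms(2)]
  let ?B = "triples n \<times> {..<3 :: nat}"
  let ?dis = "hidden_pair \<pi> -` disagreements (hidden_order n True \<pi>) \<tau>"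
  have ex: "\<exists>i<3. (b, i) \<in> ?dis" if b: "b \<in> triples n" for b
  proof -
    define x where "x i = inv \<pi> (3 * b + i)" for i
    have pos: "3 * b + i \<in> {1..n}" if "i < 3" for i using triple_position[OF b that] .
    have x: "x i \<in> {1..n}" if "i < 3" for i
      using pos[OF that] permutes_in_image[OF permutes_inv[OF perm]] unfolding x_def by blast
    have \<pi>x: "\<pi> (x i) = 3 * b + i" for i
      unfolding x_def using permutes_inverses(1)[OF perm] by simp
    have dm: "(3 * b + i) div 3 = b \<and> (3 * b + i) mod 3 = i" if "i < 3" for i
      using that by simp
    have \<sigma>: "(x 0, x 1) \<in> hidden_order n True \<pi>" "(x 1, x 2) \<in> hidden_order n True \<pi>"
      "(x 2, x 0) \<in> hidden_order n True \<pi>"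
      using x[of 0] x[of 1] x[of 2] dm[of 0] dm[of 1] dm[of 2]
      by (simp_all add: hidden_order_def \<pi>x triple_less_def)
    have ne: "x 0 \<noteq> x 1" "x 1 \<noteq> x 2" "x 2 \<noteq> x 0"
      using \<pi>x[of 0] \<pi>x[of 1] \<pi>x[of 2] by fastforce+
    have "comparison_function n \<tau>" and tr: "trans \<tau>" using \<tau> by (auto simp: total_ordering_iff)
    then have asym: "asym \<tau>" and tot: "total_on {1..n} \<tau>"
      unfolding comparison_function_def by auto
    have "(x 1, x 0) \<in> \<tau> \<or> (x 2, x 1) \<in> \<tau> \<or> (x 0, x 2) \<in> \<tau>"
    proof (rule ccontr)
      assume "\<not> ?thesis"
      moreover have "(x i, x j) \<in> \<tau> \<or> (x j, x i) \<in> \<tau>" if "i < 3" "j < 3" "x i \<noteq> x j" for i j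
        using tot x[OF that(1)] x[OF that(2)] that(3) unfolding total_on_def by blast
      from this[of 0 1] this[of 1 2] this[of 2 0]
      have "(x 0, x 1) \<in> \<tau> \<or> (x 1, x 0) \<in> \<tau>" "(x 1, x 2) \<in> \<tau> \<or> (x 2, x 1) \<in> \<tau>"
        "(x 2, x 0) \<in> \<tau> \<or> (x 0, x 2) \<in> \<tau>"
        using ne by simp_all
      ultimately have "(x 0, x 1) \<in> \<tau>" "(x 1, x 2) \<in> \<tau>" "(x 2, x 0) \<in> \<tau>" by blast+
      then show False using tr asym by (meson asymD transD)
    qed
    moreover have "hidden_pair \<pi> (b, 0) = {x 0, x 1}" "hidden_pair \<pi> (b, 1) = {x 1, x 2}"
      "hidden_pair \<pi> (b, 2) = {x 2, x 0}"
      by (simp_all add: hidden_pair_def x_def)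
    ultimately have "\<exists>i\<in>{0, 1, 2}. (b, i) \<in> ?dis"
      using \<sigma> by (auto simp: disagreements_def)
    then obtain i where "i \<in> {0, 1, 2}" "(b, i) \<in> ?dis" by blast
    then show ?thesis by (intro exI[of _ i]) auto
  qed
  obtain i where i: "\<And>b. b \<in> triples n \<Longrightarrow> i b < 3 \<and> (b, i b) \<in> ?dis"
    using ex by metis
  \<comment> \<open>Choosing one reversed pair per triple injects the triples into the
    disagreements.\<close>
  have "card (triples n) = card ((\<lambda>b. (b, i b)) ` triples n)"
    by (subst card_image) (auto simp: inj_on_def)
  also have "\<dots> \<le> card (?B \<inter> ?dis)"
    using i fin by (intro card_mono) auto
  finally have "real (card (triples n)) \<le> real (card (?B \<inter> ?dis))" by simp
  moreover have "measure_pmf.prob (hidden_pairs n \<pi>) (disagreements (hidden_order n True \<pi>) \<tau>)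
      = real (card (?B \<inter> ?dis)) / real (card ?B)"
    unfolding hidden_pairs_def measure_map_pmf using fin
    by (subst measure_pmf_of_set) (auto simp: lessThan_empty_iff)
  moreover have "card (triples n) > 0" using fin by (simp add: card_gt_0_iff)
  moreover have "real (card ?B) = 3 * real (card (triples n))"
    by (simp add: card_cartesian_product)
  moreover have "1 / 3 = real (card (triples n)) / (3 * real (card (triples n)))"
    using \<open>card (triples n) > 0\<close> by simp
  ultimately have "1 / 3 \<le> measure_pmf.prob (hidden_pairs n \<pi>) (disagreements (hidden_order n True \<pi>) \<tau>)"
    by (simp only: divide_right_mono mult_nonneg_nonneg of_nat_0_le_iff zero_le_numeral)
  then show "\<epsilon> \<le> measure_pmf.prob (hidden_pairs n \<pi>) (disagreements (hidden_order n True \<pi>) \<tau>)"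
    using assms(3) by simp
qed

section \<open>Indistinguishability\<close>

definition extensions :: "nat \<Rightarrow> nat set \<Rightarrow> (nat \<Rightarrow> nat) \<Rightarrow> (nat \<Rightarrow> nat) set" where
  "extensions n X f = {\<pi>. \<pi> permutes {1..n} \<and> (\<forall>x\<in>X. \<pi> x = f x)}"

lemma finite_extensions: "finite (extensions n X f)"
  unfolding extensions_def using finite_permutations[of "{1..n}"] by simp

text \<open>Case split on the position of a given element. This models a query, which asks where
  prescribed elements sit.\<close>

lemma sum_extensions_element:
  assumes "u \<in> {1..n} - X"
  shows "sum F (extensions n X f)
    = (\<Sum>j\<in>{1..n} - f ` X. sum F (extensions n (insert u X) (f(u := j))))"
proof -
  have "extensions n X f = (\<Union>j\<in>{1..n} - f ` X. extensions n (insert u X) (f(u := j)))"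
  proof (intro equalityI subsetI)
    fix \<pi> assume \<pi>: "\<pi> \<in> extensions n X f"
    then have perm: "\<pi> permutes {1..n}" by (simp add: extensions_def)
    have "\<pi> u \<in> {1..n}" using permutes_in_image[OF perm] assms by blast
    moreover have "\<pi> u \<notin> f ` X"
    proof
      assume "\<pi> u \<in> f ` X"
      then obtain x where "x \<in> X" "\<pi> u = \<pi> x" using \<pi> by (auto simp: extensions_def)
      then show False using permutes_inj[OF perm] assms by (auto simp: inj_eq)
    qed
    moreover have "\<pi> \<in> extensions n (insert u X) (f(u := \<pi> u))"
      using \<pi> by (auto simp: extensions_def)
    ultimately show "\<pi> \<in> (\<Union>j\<in>{1..n} - f ` X. extensions n (insert u X) (f(u := j)))" by blast
  next
    fix \<pi> assume "\<pi> \<in> (\<Union>j\<in>{1..n} - f ` X. extensions n (insert u X) (f(u := j)))"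
    then obtain j where \<pi>: "\<pi> permutes {1..n}" "\<And>x. x \<in> insert u X \<Longrightarrow> \<pi> x = (f(u := j)) x"
      unfolding extensions_def by blast
    have "\<pi> x = f x" if "x \<in> X" for x
    proof -
      have "x \<noteq> u" using that assms by blast
      then show ?thesis using \<pi>(2)[of x] that by simp
    qed
    then show "\<pi> \<in> extensions n X f" unfolding extensions_def using \<pi>(1) by blast
  qed
  moreover have "extensions n (insert u X) (f(u := i)) \<inter> extensions n (insert u X) (f(u := j)) = {}"
    if "i \<noteq> j" for i j using that by (auto simp: extensions_def)
  ultimately show ?thesis
    by (simp add: sum.UNION_disjoint finite_extensions)
qed

text \<open>The dual case split, on the element at a given position. This models a sample, which
  reveals who occupies prescribed positions.\<close>

lemma sum_extensions_position:
  assumes "p \<in> {1..n} - f ` X" "X \<subseteq> {1..n}"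
  shows "sum F (extensions n X f)
    = (\<Sum>u\<in>{1..n} - X. sum F (extensions n (insert u X) (f(u := p))))"
proof -
  have "extensions n X f = (\<Union>u\<in>{1..n} - X. extensions n (insert u X) (f(u := p)))"
  proof (intro equalityI subsetI)
    fix \<pi> assume \<pi>: "\<pi> \<in> extensions n X f"
    then have perm: "\<pi> permutes {1..n}" by (simp add: extensions_def)
    have inv: "\<pi> (inv \<pi> p) = p" using permutes_inverses(1)[OF perm] by simp
    have "inv \<pi> p \<in> {1..n}"
      using permutes_in_image[OF permutes_inv[OF perm]] assms by blast
    moreover have "inv \<pi> p \<notin> X" using \<pi> inv assms by (force simp: extensions_def)
    moreover have "\<pi> \<in> extensions n (insert (inv \<pi> p) X) (f(inv \<pi> p := p))"
      using \<pi> inv by (auto simp: extensions_def)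
    ultimately show "\<pi> \<in> (\<Union>u\<in>{1..n} - X. extensions n (insert u X) (f(u := p)))" by blast
  next
    fix \<pi> assume "\<pi> \<in> (\<Union>u\<in>{1..n} - X. extensions n (insert u X) (f(u := p)))"
    then show "\<pi> \<in> extensions n X f" by (auto simp: extensions_def split: if_splits)
  qed
  moreover have "extensions n (insert u X) (f(u := p)) \<inter> extensions n (insert v X) (f(v := p)) = {}"
    if "u \<noteq> v" for u v
    using that by (auto simp: extensions_def dest!: permutes_inj) (metis injD)
  ultimately show ?thesis
    by (simp add: sum.UNION_disjoint finite_extensions)
qed

definition partial_injection :: "nat \<Rightarrow> nat set \<Rightarrow> (nat \<Rightarrow> nat) \<Rightarrow> bool" where
  "partial_injection n X f \<longleftrightarrow> X \<subseteq> {1..n} \<and> inj_on f X \<and> f ` X \<subseteq> {1..n}"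

lemma partial_injection_card:
  assumes "partial_injection n X f"
  shows "finite X" "card X \<le> n" "card ({1..n} - X) = n - card X" "card ({1..n} - f ` X) = n - card X"
proof -
  have X: "X \<subseteq> {1..n}" "f ` X \<subseteq> {1..n}" "inj_on f X"
    using assms by (auto simp: partial_injection_def)
  show fin: "finite X" using X(1) by (rule finite_subset) simp
  show "card X \<le> n" using card_mono[OF _ X(1)] by simp
  show "card ({1..n} - X) = n - card X" using X(1) fin by (simp add: card_Diff_subset)
  show "card ({1..n} - f ` X) = n - card X"
    using X fin by (simp add: card_Diff_subset card_image)
qed

lemma partial_injection_insert:
  assumes "partial_injection n X f" "u \<in> {1..n} - X" "j \<in> {1..n} - f ` X"
  shows "partial_injection n (insert u X) (f(u := j))"
proof -
  have "inj_on (f(u := j)) (insert u X)"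
    using assms by (intro inj_onI) (auto simp: partial_injection_def inj_on_def split: if_splits)
  moreover have "(f(u := j)) ` insert u X \<subseteq> {1..n}"
    using assms by (auto simp: partial_injection_def)
  ultimately show ?thesis using assms unfolding partial_injection_def by blast
qed

lemma card_extensions:
  "partial_injection n X f \<Longrightarrow> card (extensions n X f) = fact (n - card X)"
proof (induction "n - card X" arbitrary: X f)
  case 0
  note card = partial_injection_card[OF 0(2)]
  have X: "X = {1..n}"
    using 0 card by (intro card_subset_eq) (auto simp: partial_injection_def)
  define \<pi> where "\<pi> x = (if x \<in> {1..n} then f x else x)" for x
  have f: "inj_on f {1..n}" "f ` {1..n} \<subseteq> {1..n}"
    using 0(2) unfolding partial_injection_def X by blast+
  have "bij_betw f {1..n} {1..n}"
    using f endo_inj_surj[OF _ f(2,1)] by (intro bij_betw_imageI) simp_all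
  then have "bij_betw \<pi> {1..n} {1..n}"
    by (rule bij_betw_cong[THEN iffD1, rotated]) (simp add: \<pi>_def)
  then have "\<pi> permutes {1..n}" by (rule bij_imp_permutes) (auto simp: \<pi>_def)
  moreover have "\<rho> = \<pi>" if "\<rho> permutes {1..n}" "\<forall>x\<in>{1..n}. \<rho> x = f x" for \<rho>
    using that by (simp add: \<pi>_def fun_eq_iff permutes_not_in)
  moreover have "\<forall>x\<in>{1..n}. \<pi> x = f x" by (simp add: \<pi>_def)
  ultimately have "\<rho> \<in> extensions n X f \<longleftrightarrow> \<rho> = \<pi>" for \<rho>
    unfolding extensions_def X mem_Collect_eq by blast
  then have "extensions n X f = {\<pi>}" by blast
  then show ?case using 0 by simp
next
  case (Suc d)
  note card = partial_injection_card[OF Suc(3)]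
  have "{1..n} - X \<noteq> {}" using Suc(2) card(3) by (metis card.empty nat.simps(3))
  then obtain u where u: "u \<in> {1..n} - X" by blast
  have "card (extensions n (insert u X) (f(u := j))) = fact d" if j: "j \<in> {1..n} - f ` X" for j
  proof -
    have "d = n - card (insert u X)" using Suc(2) u card(1) by simp
    then show ?thesis using Suc(1) partial_injection_insert[OF Suc(3) u j] by metis
  qed
  then have "card (extensions n X f) = (\<Sum>j\<in>{1..n} - f ` X. fact d)"
    using sum_extensions_element[OF u, of "\<lambda>_. 1 :: nat" f] by simp
  then show ?case using card(4) Suc(2)[symmetric] by simp
qed

text \<open>\<open>X\<close> is the set of elements revealed so far, \<open>f\<close> and \<open>g\<close> are their positions in the transitive
  and in the cyclic case.  The positions may differ inside a triple; all that matters is that the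
  algorithm has seen the same answers.  As \<open>f\<close> and \<open>g\<close> have equally many extensions to permutations,
  unnormalised sums over the extensions can be compared.\<close>

definition coupled :: "nat \<Rightarrow> nat set \<Rightarrow> (nat \<Rightarrow> nat) \<Rightarrow> (nat \<Rightarrow> nat) \<Rightarrow> bool" where
  "coupled n X f g \<longleftrightarrow> partial_injection n X f \<and> partial_injection n X g \<and>
     (\<forall>x\<in>X. f x div 3 = g x div 3) \<and>
     (\<forall>x\<in>X. \<forall>y\<in>X. triple_less False (f x) (f y) \<longleftrightarrow> triple_less True (g x) (g y))"

lemma coupled_insert:
  assumes "coupled n X f g" "u \<in> {1..n} - X" "p \<in> {1..n} - f ` X" "q \<in> {1..n} - g ` X"
    and div: "p div 3 = q div 3"
    and less: "\<And>y. y \<in> X \<Longrightarrow> triple_less False p (f y) \<longleftrightarrow> triple_less True q (g y)"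
      "\<And>y. y \<in> X \<Longrightarrow> triple_less False (f y) p \<longleftrightarrow> triple_less True (g y) q"
  shows "coupled n (insert u X) (f(u := p)) (g(u := q))"
proof -
  have c: "partial_injection n X f" "partial_injection n X g"
    "\<And>x. x \<in> X \<Longrightarrow> f x div 3 = g x div 3"
    "\<And>x y. x \<in> X \<Longrightarrow> y \<in> X \<Longrightarrow> triple_less False (f x) (f y) \<longleftrightarrow> triple_less True (g x) (g y)"
    using assms(1) unfolding coupled_def by blast+
  have "\<not> triple_less False p p" "\<not> triple_less True q q" using triple_less_asym by blast+
  then have "triple_less False ((f(u := p)) x) ((f(u := p)) y)
      \<longleftrightarrow> triple_less True ((g(u := q)) x) ((g(u := q)) y)"
    if "x \<in> insert u X" "y \<in> insert u X" for x y
    using that less c(4) by (cases "x = u"; cases "y = u") simp_all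
  moreover have "(f(u := p)) x div 3 = (g(u := q)) x div 3" if "x \<in> insert u X" for x
    using that div c(3) by (cases "x = u") simp_all
  ultimately show ?thesis
    using partial_injection_insert[OF c(1) assms(2,3)] partial_injection_insert[OF c(2) assms(2,4)]
    unfolding coupled_def by blast
qed

lemma coupled_touched: "coupled n X f g \<Longrightarrow> (\<lambda>x. g x div 3) ` X = (\<lambda>x. f x div 3) ` X"
  unfolding coupled_def by (intro image_cong) simp_all

text \<open>All comparisons with the new element are across triples, where
  \<open>triple_less_other\<close> reduces them to block numbers, and these agree on both
  sides.\<close>

lemma coupled_insert_fresh:
  assumes "coupled n X f g" "u \<in> {1..n} - X" "p \<in> {1..n}" "q \<in> {1..n}"
    and div: "p div 3 = q div 3" and fresh: "p div 3 \<notin> (\<lambda>x. f x div 3) ` X"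
  shows "coupled n (insert u X) (f(u := p)) (g(u := q))"
proof (rule coupled_insert[OF assms(1,2) _ _ div])
  have ne: "p div 3 \<noteq> f y div 3" "q div 3 \<noteq> g y div 3" "f y div 3 = g y div 3" if "y \<in> X" for y
    using that fresh div assms(1) unfolding coupled_def by auto
  show "p \<in> {1..n} - f ` X" "q \<in> {1..n} - g ` X" using assms(3,4) ne(1,2) by blast+
  fix y assume "y \<in> X"
  note ne = ne[OF this]
  show "triple_less False p (f y) \<longleftrightarrow> triple_less True q (g y)"
    unfolding triple_less_other[OF ne(1)] triple_less_other[OF ne(2)] using div ne(3) by simp
  show "triple_less False (f y) p \<longleftrightarrow> triple_less True (g y) q"
    unfolding triple_less_other[OF ne(1)[symmetric]] triple_less_other[OF ne(2)[symmetric]]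
    using div ne(3) by simp
qed

section \<open>Revealing elements and sampled pairs\<close>

lemma abs_diff_le_if_bounds:
  fixes a b :: real
  assumes "0 \<le> a" "a \<le> c" "0 \<le> b" "b \<le> c"
  shows "\<bar>a - b\<bar> \<le> c"
  using assms by linarith

lemma sum_extensions_bounds:
  fixes F :: "_ \<Rightarrow> real"
  assumes "partial_injection n X f" "\<And>\<pi>. 0 \<le> F \<pi>" "\<And>\<pi>. F \<pi> \<le> 1"
  shows "0 \<le> sum F (extensions n X f)" "sum F (extensions n X f) \<le> fact (n - card X)"
proof -
  show "0 \<le> sum F (extensions n X f)" using assms(2) by (intro sum_nonneg)
  have "sum F (extensions n X f) \<le> (\<Sum>\<pi>\<in>extensions n X f. 1)"
    using assms(3) by (intro sum_mono)
  then show "sum F (extensions n X f) \<le> fact (n - card X)"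
    by (simp add: card_extensions[OF assms(1)])
qed

text \<open>If \<open>u\<close> is placed in an untouched triple, the same position is used on both
  sides and the coupling survives. At most three positions per revealed element lie in touched
  triples. Among at least n/2 free positions they have total probability at most 6T/n, and are given
  up.\<close>

lemma reveal:
  fixes F G :: "(nat \<Rightarrow> nat) \<Rightarrow> real"
  assumes coupled: "coupled n X f g" and u: "u \<in> {1..n}"
    and F: "\<And>\<pi>. 0 \<le> F \<pi>" "\<And>\<pi>. F \<pi> \<le> 1" and G: "\<And>\<pi>. 0 \<le> G \<pi>" "\<And>\<pi>. G \<pi> \<le> 1"
    and T: "card X \<le> T" "2 * T \<le> n" and "0 \<le> \<Delta>"
    and step: "\<And>Y f' g'. coupled n Y f' g' \<Longrightarrow> X \<subseteq> Y \<Longrightarrow> u \<in> Y \<Longrightarrow> card Y \<le> card X + 1 \<Longrightarrow>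
      \<bar>sum F (extensions n Y f') - sum G (extensions n Y g')\<bar> \<le> \<Delta> * fact (n - card Y)"
  shows "\<bar>sum F (extensions n X f) - sum G (extensions n X g)\<bar>
    \<le> (\<Delta> + 6 * real T / real n) * fact (n - card X)"
proof (cases "u \<in> X")
  case True
  have "\<bar>sum F (extensions n X f) - sum G (extensions n X g)\<bar> \<le> \<Delta> * fact (n - card X)"
    using step[OF coupled _ True] by simp
  also have "\<dots> \<le> (\<Delta> + 6 * real T / real n) * fact (n - card X)"
    by (intro mult_right_mono) auto
  finally show ?thesis .
next
  case False
  then have u: "u \<in> {1..n} - X" using u by blast
  have pf: "partial_injection n X f" and pg: "partial_injection n X g"
    using coupled unfolding coupled_def by blast+
  note card = partial_injection_card[OF pf]
  have cardY: "card (insert u X) = Suc (card X)" using u card(1) by simp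
  define t where "t = (\<lambda>x. f x div 3) ` X"
  define Jf where "Jf = {1..n} - f ` X"
  define Jg where "Jg = {1..n} - g ` X"
  \<comment> \<open>These positions are free on both sides at once, because \<open>f\<close> and
    \<open>g\<close> touch the same triples.\<close>
  define J where "J = {j \<in> {1..n}. j div 3 \<notin> t}"
  define Bf where "Bf = Jf - J"
  define Bg where "Bg = Jg - J"
  define N where "N = n - card X"
  define E where "E = (fact (N - 1) :: real)"
  have t': "t = (\<lambda>x. g x div 3) ` X" using coupled_touched[OF coupled] by (simp add: t_def)
  have J: "J \<subseteq> Jf" "J \<subseteq> Jg" unfolding J_def Jf_def Jg_def using t_def t' by blast+
  have fin: "finite Jf" "finite Jg" "finite J" by (auto simp: Jf_def Jg_def J_def)
  have cardJ: "card J \<le> N"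
    using card_mono[OF fin(1) J(1)] card(4) by (simp add: Jf_def N_def)
  have blocks: "{j \<in> {1..n}. j div 3 \<in> t} \<subseteq> (\<lambda>(b, i). 3 * b + i) ` (t \<times> {..<3})"
  proof
    fix j assume "j \<in> {j \<in> {1..n}. j div 3 \<in> t}"
    then have "(j div 3, j mod 3) \<in> t \<times> {..<3}" by simp
    moreover have "j = (\<lambda>(b, i). 3 * b + i) (j div 3, j mod 3)" by simp
    ultimately show "j \<in> (\<lambda>(b, i). 3 * b + i) ` (t \<times> {..<3})" by blast
  qed
  have fint: "finite t" using card(1) by (simp add: t_def)
  have "card {j \<in> {1..n}. j div 3 \<in> t} \<le> card (t \<times> {..<3 :: nat})"
    using surj_card_le[OF _ blocks] fint by simp
  also have "\<dots> \<le> 3 * card X"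
    using card_image_le[OF card(1), of "\<lambda>x. f x div 3"] by (simp add: card_cartesian_product t_def)
  finally have blocks: "card {j \<in> {1..n}. j div 3 \<in> t} \<le> 3 * card X" .
  have cardB: "card Bf \<le> 3 * card X" "card Bg \<le> 3 * card X"
  proof -
    have "Bf \<subseteq> {j \<in> {1..n}. j div 3 \<in> t}" "Bg \<subseteq> {j \<in> {1..n}. j div 3 \<in> t}"
      by (auto simp: Bf_def Bg_def Jf_def Jg_def J_def)
    then show "card Bf \<le> 3 * card X" "card Bg \<le> 3 * card X"
      by (blast intro: order_trans[OF card_mono blocks] finite_subset[OF _ finite_atLeastAtMost])+
  qed
  define SF where "SF j = sum F (extensions n (insert u X) (f(u := j)))" for j
  define SG where "SG j = sum G (extensions n (insert u X) (g(u := j)))" for j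
  have SF: "0 \<le> SF j" "SF j \<le> E" if "j \<in> Jf" for j
    using sum_extensions_bounds[OF partial_injection_insert[OF pf u] F] that cardY
    unfolding SF_def E_def N_def Jf_def by auto
  have SG: "0 \<le> SG j" "SG j \<le> E" if "j \<in> Jg" for j
    using sum_extensions_bounds[OF partial_injection_insert[OF pg u] G] that cardY
    unfolding SG_def E_def N_def Jg_def by auto
  have "sum F (extensions n X f) = sum SF Jf"
    using sum_extensions_element[OF u] unfolding SF_def Jf_def .
  also have "\<dots> = sum SF J + sum SF Bf"
    unfolding Bf_def using J fin by (simp add: sum.subset_diff)
  finally have F_eq: "sum F (extensions n X f) = sum SF J + sum SF Bf" .
  have "sum G (extensions n X g) = sum SG Jg"
    using sum_extensions_element[OF u] unfolding SG_def Jg_def .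
  also have "\<dots> = sum SG J + sum SG Bg"
    unfolding Bg_def using J fin by (simp add: sum.subset_diff)
  finally have G_eq: "sum G (extensions n X g) = sum SG J + sum SG Bg" .
  have good: "\<bar>sum SF J - sum SG J\<bar> \<le> real N * (\<Delta> * E)"
  proof -
    have "\<bar>SF j - SG j\<bar> \<le> \<Delta> * E" if "j \<in> J" for j
    proof -
      have "coupled n (insert u X) (f(u := j)) (g(u := j))"
        using that coupled u by (intro coupled_insert_fresh) (auto simp: J_def t_def)
      from step[OF this] show ?thesis
        using cardY unfolding SF_def SG_def E_def N_def by auto
    qed
    then have "(\<Sum>j\<in>J. \<bar>SF j - SG j\<bar>) \<le> real (card J) * (\<Delta> * E)"
      by (rule sum_bounded_above)
    also have "\<dots> \<le> real N * (\<Delta> * E)"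
      using cardJ \<open>0 \<le> \<Delta>\<close> by (intro mult_right_mono) (auto simp: E_def)
    finally show ?thesis
      using sum_abs[of "\<lambda>j. SF j - SG j" J] by (simp add: sum_subtractf)
  qed
  \<comment> \<open>Here positions are not matched; both sums merely lie in the same interval
    starting at 0.\<close>
  have bad: "\<bar>sum SF Bf - sum SG Bg\<bar> \<le> 3 * real (card X) * E"
  proof (rule abs_diff_le_if_bounds)
    have sub: "Bf \<subseteq> Jf" "Bg \<subseteq> Jg" by (auto simp: Bf_def Bg_def)
    show "0 \<le> sum SF Bf" "0 \<le> sum SG Bg" using SF(1) SG(1) sub by (auto intro!: sum_nonneg)
    have "sum SF Bf \<le> real (card Bf) * E" "sum SG Bg \<le> real (card Bg) * E"
      using SF(2) SG(2) sub by (auto intro!: sum_bounded_above)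
    moreover have "real (card Bf) * E \<le> 3 * real (card X) * E"
      "real (card Bg) * E \<le> 3 * real (card X) * E"
      using cardB by (intro mult_right_mono; simp add: E_def)+
    ultimately show "sum SF Bf \<le> 3 * real (card X) * E" "sum SG Bg \<le> 3 * real (card X) * E"
      by linarith+
  qed
  have "card X < n" using card_mono[of "{1..n}" "insert u X"] u cardY card(1) pf
    unfolding partial_injection_def by auto
  then have "n > 0" "N > 0" by (auto simp: N_def)
  have fact: "real N * E = fact N"
    using \<open>N > 0\<close> unfolding E_def by (cases N) simp_all
  have "3 * real (card X) * E \<le> 6 * real T / real n * (real N * E)"
  proof -
    have "real n \<le> 2 * real N" using T unfolding N_def by simp
    then have "3 * real (card X) * real n \<le> 3 * real T * (2 * real N)"
      using T(1) by (intro mult_mono) auto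
    then have "3 * real (card X) \<le> 6 * real T / real n * real N"
      using \<open>n > 0\<close> by (simp add: pos_le_divide_eq)
    then have "3 * real (card X) * E \<le> (6 * real T / real n * real N) * E"
      by (intro mult_right_mono) (auto simp: E_def)
    then show ?thesis by (simp only: mult.assoc)
  qed
  then have "\<bar>sum F (extensions n X f) - sum G (extensions n X g)\<bar>
      \<le> \<Delta> * (real N * E) + 6 * real T / real n * (real N * E)"
    unfolding F_eq G_eq using good bad by (simp only: mult.left_commute[of \<Delta>])
  then show ?thesis unfolding fact N_def[symmetric] by (simp only: distrib_right)
qed

lemma sum_extensions_pair:
  assumes "p \<in> {1..n} - f ` X" "q \<in> {1..n} - f ` X" "p \<noteq> q" "X \<subseteq> {1..n}"
  shows "sum F (extensions n X f) = (\<Sum>u\<in>{1..n} - X. \<Sum>v\<in>{1..n} - insert u X.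
    sum F (extensions n (insert v (insert u X)) (f(u := p, v := q))))"
proof -
  have "sum F (extensions n (insert u X) (f(u := p))) = (\<Sum>v\<in>{1..n} - insert u X.
      sum F (extensions n (insert v (insert u X)) (f(u := p, v := q))))"
    if u: "u \<in> {1..n} - X" for u
  proof (rule sum_extensions_position)
    have im: "(f(u := p)) ` insert u X = insert p (f ` X)" using u by auto
    show "q \<in> {1..n} - (f(u := p)) ` insert u X" unfolding im using assms by blast
    show "insert u X \<subseteq> {1..n}" using u assms by blast
  qed
  then show ?thesis
    unfolding sum_extensions_position[OF assms(1,4)] by (rule sum.cong[OF refl])
qed

text \<open>A sample from an untouched triple costs nothing. Summing over the ordered pairs of
  unrevealed elements, the lesser one is put at \<open>p\<close> or \<open>p'\<close> and the
  greater one at \<open>q\<close> or \<open>q'\<close>, so both sides show the same orientation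
  although the positions may differ.\<close>

lemma reveal_pair:
  fixes F G :: "(nat \<Rightarrow> nat) \<Rightarrow> real"
  assumes coupled: "coupled n X f g"
    and fresh: "b \<notin> (\<lambda>x. f x div 3) ` X"
    and pos: "p \<in> {1..n}" "q \<in> {1..n}" "p' \<in> {1..n}" "q' \<in> {1..n}"
    and block: "p div 3 = b" "q div 3 = b" "p' div 3 = b" "q' div 3 = b"
    and less: "triple_less False p q" "triple_less True p' q'"
    and step: "\<And>u v. u \<noteq> v \<Longrightarrow> u \<notin> X \<Longrightarrow> v \<notin> X \<Longrightarrow>
      coupled n (insert v (insert u X)) (f(u := p, v := q)) (g(u := p', v := q')) \<Longrightarrow>
      \<bar>sum F (extensions n (insert v (insert u X)) (f(u := p, v := q)))
        - sum G (extensions n (insert v (insert u X)) (g(u := p', v := q')))\<bar>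
      \<le> \<Delta> * fact (n - card (insert v (insert u X)))"
  shows "\<bar>sum F (extensions n X f) - sum G (extensions n X g)\<bar> \<le> \<Delta> * fact (n - card X)"
proof -
  have pf: "partial_injection n X f" and pg: "partial_injection n X g"
    using coupled unfolding coupled_def by blast+
  note card = partial_injection_card[OF pf]
  define N where "N = n - card X"
  have freshg: "b \<notin> (\<lambda>x. g x div 3) ` X" using fresh coupled_touched[OF coupled] by simp
  have ne: "p \<noteq> q" "p' \<noteq> q'" using less triple_less_asym by blast+
  have nf: "p \<in> {1..n} - f ` X" "q \<in> {1..n} - f ` X" "p' \<in> {1..n} - g ` X" "q' \<in> {1..n} - g ` X"
    using pos block fresh freshg by blast+
  have X: "X \<subseteq> {1..n}" using pf by (simp add: partial_injection_def)
  have "card {p, q} \<le> card ({1..n} - f ` X)" using nf by (intro card_mono) auto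
  then have "2 \<le> N" using ne card(4) by (simp add: N_def)
  then obtain M where M: "N = Suc (Suc M)" by (metis add_2_eq_Suc le_Suc_ex)
  define SF where "SF u v = sum F (extensions n (insert v (insert u X)) (f(u := p, v := q)))" for u v
  define SG where "SG u v = sum G (extensions n (insert v (insert u X)) (g(u := p', v := q')))" for u v
  have close: "\<bar>SF u v - SG u v\<bar> \<le> \<Delta> * fact M"
    if u: "u \<in> {1..n} - X" and v: "v \<in> {1..n} - insert u X" for u v
  proof -
    have uv: "u \<noteq> v" "u \<notin> X" "v \<notin> X" using u v by blast+
    have c1: "coupled n (insert u X) (f(u := p)) (g(u := p'))"
      using coupled u pos block fresh by (intro coupled_insert_fresh) simp_all
    have "coupled n (insert v (insert u X)) (f(u := p, v := q)) (g(u := p', v := q'))"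
    proof (rule coupled_insert[OF c1 v])
      show "q \<in> {1..n} - (f(u := p)) ` insert u X" "q' \<in> {1..n} - (g(u := p')) ` insert u X"
        using nf ne uv by (simp_all add: image_iff)
      show "q div 3 = q' div 3" using block by simp
      fix y assume y: "y \<in> insert u X"
      have "(triple_less False q ((f(u := p)) y) \<longleftrightarrow> triple_less True q' ((g(u := p')) y)) \<and>
        (triple_less False ((f(u := p)) y) q \<longleftrightarrow> triple_less True ((g(u := p')) y) q')"
      \<comment> \<open>The only new comparison inside a triple is that of \<open>u\<close> and
        \<open>v\<close>, and \<open>less\<close> makes it equal on both sides.\<close>
      proof (cases "y = u")
        case True
        then show ?thesis using less triple_less_asym by auto
      next
        case False
        then have "y \<in> X" using y by blast
        then have d: "q div 3 \<noteq> f y div 3" "q' div 3 \<noteq> g y div 3" "f y div 3 = g y div 3"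
          using fresh freshg block coupled unfolding coupled_def by auto
        show ?thesis
          using False d block
          by (simp add: triple_less_other[OF d(1)] triple_less_other[OF d(2)]
              triple_less_other[OF d(1)[symmetric]] triple_less_other[OF d(2)[symmetric]])
      qed
      then show "triple_less False q ((f(u := p)) y) \<longleftrightarrow> triple_less True q' ((g(u := p')) y)"
        "triple_less False ((f(u := p)) y) q \<longleftrightarrow> triple_less True ((g(u := p')) y) q'" by blast+
    qed
    moreover have "n - card (insert v (insert u X)) = M"
      using uv card(1) M by (simp add: N_def)
    ultimately show ?thesis using step[OF uv] unfolding SF_def SG_def by simp
  qed
  have inner: "\<bar>sum (SF u) ({1..n} - insert u X) - sum (SG u) ({1..n} - insert u X)\<bar>
      \<le> real (Suc M) * (\<Delta> * fact M)" if u: "u \<in> {1..n} - X" for u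
  proof -
    have "{1..n} - insert u X = ({1..n} - X) - {u}" by blast
    then have c: "card ({1..n} - insert u X) = Suc M"
      using u card(3) M by (simp add: N_def)
    have "(\<Sum>v\<in>{1..n} - insert u X. \<bar>SF u v - SG u v\<bar>)
        \<le> real (card ({1..n} - insert u X)) * (\<Delta> * fact M)"
      using close[OF u] by (intro sum_bounded_above) blast
    then show ?thesis
      using sum_abs[of "\<lambda>v. SF u v - SG u v" "{1..n} - insert u X"]
      unfolding c sum_subtractf by linarith
  qed
  have c: "card ({1..n} - X) = Suc (Suc M)" using card(3) M by (simp add: N_def)
  have "(\<Sum>u\<in>{1..n} - X. \<bar>sum (SF u) ({1..n} - insert u X) - sum (SG u) ({1..n} - insert u X)\<bar>)
      \<le> real (card ({1..n} - X)) * (real (Suc M) * (\<Delta> * fact M))"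
    using inner by (intro sum_bounded_above) blast
  then have "\<bar>(\<Sum>u\<in>{1..n} - X. sum (SF u) ({1..n} - insert u X))
        - (\<Sum>u\<in>{1..n} - X. sum (SG u) ({1..n} - insert u X))\<bar>
      \<le> real (Suc (Suc M)) * (real (Suc M) * (\<Delta> * fact M))"
    using sum_abs[of "\<lambda>u. sum (SF u) ({1..n} - insert u X) - sum (SG u) ({1..n} - insert u X)"
        "{1..n} - X"]
    unfolding c sum_subtractf by linarith
  moreover have "real (Suc (Suc M)) * (real (Suc M) * (\<Delta> * fact M)) = \<Delta> * fact (n - card X)"
    unfolding N_def[symmetric] M by (simp only: fact_Suc of_nat_mult mult_ac)
  ultimately show ?thesis
    unfolding sum_extensions_pair[OF nf(1,2) ne(1) X] sum_extensions_pair[OF nf(3,4) ne(2) X]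
      SF_def SG_def by (simp only:)
qed

text \<open>Only the last pair of a triple is oriented differently in the cyclic and the transitive
  instance.\<close>

definition lower :: "bool \<Rightarrow> nat \<Rightarrow> nat" where
  "lower c i = (if i = 2 \<and> \<not> c then 0 else i)"

definition upper :: "bool \<Rightarrow> nat \<Rightarrow> nat" where
  "upper c i = (if i = 2 \<and> \<not> c then 2 else (i + 1) mod 3)"

lemma lower_upper:
  assumes "i < 3"
  shows "lower c i < 3" "upper c i < 3"
    "{3 * b + i, 3 * b + (i + 1) mod 3} = {3 * b + lower c i, 3 * b + upper c i}"
    "triple_less c (3 * b + lower c i) (3 * b + upper c i)"
proof -
  have dm: "(3 * b + j) div 3 = b \<and> (3 * b + j) mod 3 = j" if "j < 3" for j
    using that by simp
  have "i = 0 \<or> i = 1 \<or> i = 2" using assms by linarith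
  then have "lower c i < 3 \<and> upper c i < 3 \<and>
    {3 * b + i, 3 * b + (i + 1) mod 3} = {3 * b + lower c i, 3 * b + upper c i} \<and>
    triple_less c (3 * b + lower c i) (3 * b + upper c i)"
    using dm[of 0] dm[of 1] dm[of 2]
    by (elim disjE; cases c; simp add: lower_def upper_def triple_less_def insert_commute)
  then show "lower c i < 3" "upper c i < 3"
    "{3 * b + i, 3 * b + (i + 1) mod 3} = {3 * b + lower c i, 3 * b + upper c i}"
    "triple_less c (3 * b + lower c i) (3 * b + upper c i)"
    by blast+
qed

section \<open>Comparison of the acceptance probabilities\<close>

abbreviation accept :: "nat \<Rightarrow> bool \<Rightarrow> strategy \<Rightarrow> (nat \<Rightarrow> nat) \<Rightarrow> real" where
  "accept n c s \<pi> \<equiv> acceptance (hidden_order n c \<pi>) (hidden_pairs n \<pi>) s"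

lemma accept_Sample:
  assumes "n \<ge> 16"
  shows "accept n c (Sample k) \<pi>
    = (\<Sum>(b, i)\<in>triples n \<times> {..<3}. accept n c (k (hidden_pair \<pi> (b, i))) \<pi>)
      / (3 * real (card (triples n)))"
  using triples_finite_nonempty[OF assms] unfolding hidden_pairs_def
  by (simp add: integral_pmf_of_set lessThan_empty_iff card_cartesian_product
      case_prod_beta mult.commute)

text \<open>A step reveals at most two elements, which the invariant
  \<open>card X + 2 * q \<le> T\<close> accounts for, and costs at most 12T/n. A query pays for
  \<open>reveal\<close> twice; a sample pays only for hitting a touched triple, which has
  probability at most T over the number of complete triples.\<close>

lemma accept_close:
  assumes n: "n \<ge> 16" and T: "2 * T \<le> n"
    and "coupled n X f g" "card X + 2 * q \<le> T"
  shows "\<bar>sum (accept n False (truncate s q)) (extensions n X f)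
      - sum (accept n True (truncate s q)) (extensions n X g)\<bar>
    \<le> real q * (12 * real T / real n) * fact (n - card X)"
  using assms(3,4)
proof (induction s arbitrary: q X f g)
  case (Output b)
  have "partial_injection n X f" "partial_injection n X g"
    using Output unfolding coupled_def by blast+
  then show ?case by (simp add: card_extensions)
next
  case (Query u v k)
  have const: "card (extensions n X f) = card (extensions n X g)"
    using Query.prems(1) unfolding coupled_def by (simp add: card_extensions)
  show ?case
  proof (cases q)
    case 0
    then show ?thesis using const by simp
  next
    case (Suc r)
    define \<Delta> where "\<Delta> = real r * (12 * real T / real n)"
    have "\<Delta> \<ge> 0" by (simp add: \<Delta>_def)
    have IH: "\<bar>sum (accept n False (truncate (k a) r)) (extensions n Y f')
        - sum (accept n True (truncate (k a) r)) (extensions n Y g')\<bar> \<le> \<Delta> * fact (n - card Y)"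
      if "coupled n Y f' g'" "card Y \<le> card X + 2" for a Y f' g'
      unfolding \<Delta>_def using that Query.prems(2) Suc by (intro Query.IH[OF rangeI]) simp_all
    define F where "F c \<pi> = accept n c (truncate (Query u v k) q) \<pi>" for c \<pi>
    have F: "0 \<le> F c \<pi>" "F c \<pi> \<le> 1" for c \<pi>
      unfolding F_def by (rule acceptance_nonneg acceptance_le_1)+
    have F_eq: "F c \<pi> = accept n c (truncate (k ((u, v) \<in> hidden_order n c \<pi>)) r) \<pi>" for c \<pi>
      unfolding F_def Suc by simp
    have goal: "\<bar>sum (F False) (extensions n X f) - sum (F True) (extensions n X g)\<bar>
        \<le> (\<Delta> + 6 * real T / real n + 6 * real T / real n) * fact (n - card X)"
    proof (cases "u \<in> {1..n} \<and> v \<in> {1..n}")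
      case False
      \<comment> \<open>Outside [n] the answer is always \<open>False\<close>, so nothing needs to
        be revealed.\<close>
      then have "(u, v) \<notin> hidden_order n c \<pi>" for c \<pi> unfolding hidden_order_def by blast
      then have "\<bar>sum (F False) (extensions n X f) - sum (F True) (extensions n X g)\<bar>
          \<le> \<Delta> * fact (n - card X)"
        unfolding F_eq using IH[OF Query.prems(1), of False] by simp
      also have "\<dots> \<le> (\<Delta> + 6 * real T / real n + 6 * real T / real n) * fact (n - card X)"
        by (intro mult_right_mono) simp_all
      finally show ?thesis .
    next
      case True
      \<comment> \<open>Once both elements are revealed, the coupling fixes one common answer for
        all extensions on either side, and a single continuation remains.\<close>
      have known: "\<bar>sum (F False) (extensions n Y f') - sum (F True) (extensions n Y g')\<bar>
          \<le> \<Delta> * fact (n - card Y)"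
        if c: "coupled n Y f' g'" and Y: "u \<in> Y" "v \<in> Y" "card Y \<le> card X + 2" for Y f' g'
      proof -
        define a where "a = triple_less False (f' u) (f' v)"
        have a: "a = triple_less True (g' u) (g' v)"
          using c Y unfolding a_def coupled_def by blast
        have "F False \<pi> = accept n False (truncate (k a) r) \<pi>" if "\<pi> \<in> extensions n Y f'" for \<pi>
          using that Y True unfolding F_eq a_def hidden_order_def extensions_def by simp
        moreover have "F True \<pi> = accept n True (truncate (k a) r) \<pi>" if "\<pi> \<in> extensions n Y g'" for \<pi>
          using that Y True unfolding F_eq a hidden_order_def extensions_def by simp
        ultimately show ?thesis using IH[OF c Y(3), of a] by simp
      qed
      show ?thesis
      proof (rule reveal[OF Query.prems(1), of u _ _ T])
        fix Y f' g' assume Y: "coupled n Y f' g'" "X \<subseteq> Y" "u \<in> Y" "card Y \<le> card X + 1"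
        show "\<bar>sum (F False) (extensions n Y f') - sum (F True) (extensions n Y g')\<bar>
            \<le> (\<Delta> + 6 * real T / real n) * fact (n - card Y)"
        proof (rule reveal[OF Y(1), of v _ _ T])
          fix Z f'' g'' assume "coupled n Z f'' g''" "Y \<subseteq> Z" "v \<in> Z" "card Z \<le> card Y + 1"
          then show "\<bar>sum (F False) (extensions n Z f'') - sum (F True) (extensions n Z g'')\<bar>
              \<le> \<Delta> * fact (n - card Z)"
            using Y by (intro known) auto
        qed (use True F T \<open>\<Delta> \<ge> 0\<close> Y(4) Query.prems(2) Suc in simp_all)
      qed (use True F T \<open>\<Delta> \<ge> 0\<close> Query.prems(2) Suc in simp_all)
    qed
    have "\<Delta> + 6 * real T / real n + 6 * real T / real n = real q * (12 * real T / real n)"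
      unfolding \<Delta>_def Suc by (simp add: distrib_right add_divide_distrib[symmetric])
    then show ?thesis using goal unfolding F_def by simp
  qed
next
  case (Sample k)
  have pf: "partial_injection n X f" and pg: "partial_injection n X g"
    using Sample.prems(1) unfolding coupled_def by blast+
  show ?case
  proof (cases q)
    case 0
    then show ?thesis using pf pg by (simp add: card_extensions)
  next
    case (Suc r)
    define \<Delta> where "\<Delta> = real r * (12 * real T / real n)"
    have "\<Delta> \<ge> 0" by (simp add: \<Delta>_def)
    define t where "t = (\<lambda>x. f x div 3) ` X"
    define m where "m = card (triples n)"
    note fin = triples_finite_nonempty[OF n]
    have m: "real n \<le> 4 * real m" using fin(3) by (simp add: m_def)
    have "n > 0" using n by simp
    then have "m > 0" using m by linarith
    define F where "F c b i \<pi> = accept n c (truncate (k (hidden_pair \<pi> (b, i))) r) \<pi>" for c b i \<pi>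
    have F: "0 \<le> F c b i \<pi>" "F c b i \<pi> \<le> 1" for c b i \<pi>
      unfolding F_def by (rule acceptance_nonneg acceptance_le_1)+
    let ?d = "\<lambda>b i. \<bar>sum (F False b i) (extensions n X f) - sum (F True b i) (extensions n X g)\<bar>"
    have fresh: "?d b i \<le> \<Delta> * fact (n - card X)"
      if b: "b \<in> triples n" "b \<notin> t" and i: "i < 3" for b i
    proof (rule reveal_pair[OF Sample.prems(1)])
      show "b \<notin> (\<lambda>x. f x div 3) ` X" using b(2) by (simp add: t_def)
      note lu = lower_upper[OF i]
      show "3 * b + lower False i \<in> {1..n}" "3 * b + upper False i \<in> {1..n}"
        "3 * b + lower True i \<in> {1..n}" "3 * b + upper True i \<in> {1..n}"
        using triple_position[OF b(1)] lu(1,2) by blast+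
      show "(3 * b + lower False i) div 3 = b" "(3 * b + upper False i) div 3 = b"
        "(3 * b + lower True i) div 3 = b" "(3 * b + upper True i) div 3 = b"
        using lu(1,2) by simp_all
      show "triple_less False (3 * b + lower False i) (3 * b + upper False i)"
        "triple_less True (3 * b + lower True i) (3 * b + upper True i)"
        using lu(4) by blast+
      fix u v
      let ?Y = "insert v (insert u X)"
      let ?f = "f(u := 3 * b + lower False i, v := 3 * b + upper False i)"
      let ?g = "g(u := 3 * b + lower True i, v := 3 * b + upper True i)"
      assume uv: "u \<noteq> v" "u \<notin> X" "v \<notin> X" and c: "coupled n ?Y ?f ?g"
      have pair: "hidden_pair \<pi> (b, i) = {u, v}"
        if "\<pi> permutes {1..n}" "\<pi> u = 3 * b + lower c i" "\<pi> v = 3 * b + upper c i" for \<pi> c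
      proof -
        have "hidden_pair \<pi> (b, i) = inv \<pi> ` {3 * b + i, 3 * b + (i + 1) mod 3}"
          by (simp add: hidden_pair_def)
        also have "\<dots> = inv \<pi> ` {\<pi> u, \<pi> v}" unfolding lu(3)[of b c] that(2,3) ..
        also have "\<dots> = {u, v}" by (simp add: permutes_inverses(2)[OF that(1)])
        finally show ?thesis .
      qed
      have "F False b i \<pi> = accept n False (truncate (k {u, v}) r) \<pi>"
        if "\<pi> \<in> extensions n ?Y ?f" for \<pi>
        using that pair[of \<pi> False] uv(1) unfolding F_def extensions_def by simp
      moreover have "F True b i \<pi> = accept n True (truncate (k {u, v}) r) \<pi>"
        if "\<pi> \<in> extensions n ?Y ?g" for \<pi>
        using that pair[of \<pi> True] uv(1) unfolding F_def extensions_def by simp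
      moreover have "\<bar>sum (accept n False (truncate (k {u, v}) r)) (extensions n ?Y ?f)
          - sum (accept n True (truncate (k {u, v}) r)) (extensions n ?Y ?g)\<bar>
          \<le> \<Delta> * fact (n - card ?Y)"
        unfolding \<Delta>_def using Sample.prems(2) Suc uv partial_injection_card(1)[OF pf]
        by (intro Sample.IH[OF rangeI c]) simp
      ultimately show "\<bar>sum (F False b i) (extensions n ?Y ?f) - sum (F True b i) (extensions n ?Y ?g)\<bar>
          \<le> \<Delta> * fact (n - card ?Y)" by simp
    qed
    have any: "?d b i \<le> fact (n - card X)" for b i
      using sum_extensions_bounds[OF pf F] sum_extensions_bounds[OF pg F]
      by (rule abs_diff_le_if_bounds)
    \<comment> \<open>In a touched triple only the trivial bound is used; summed over all triples
      this contributes at most \<open>card t\<close>.\<close>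
    have each: "?d b i \<le> (of_bool (b \<in> t) + \<Delta>) * fact (n - card X)"
      if "b \<in> triples n" "i < 3" for b i
    proof (cases "b \<in> t")
      case True
      have "?d b i \<le> 1 * fact (n - card X)" using any[of b i] by simp
      also have "\<dots> \<le> (1 + \<Delta>) * fact (n - card X)"
        using \<open>\<Delta> \<ge> 0\<close> by (intro mult_right_mono) simp_all
      finally show ?thesis using True by simp
    qed (use fresh that in simp)
    have fint: "finite t" "card t \<le> card X"
      using partial_injection_card(1)[OF pf] card_image_le unfolding t_def by auto
    have "(\<Sum>b\<in>triples n. of_bool (b \<in> t)) = real (card (triples n \<inter> t))"
      using fin(1) by (simp add: Int_def)
    also have "\<dots> \<le> real T"
      using card_mono[of t "triples n \<inter> t"] fint Sample.prems(2) by simp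
    finally have touched: "(\<Sum>b\<in>triples n. of_bool (b \<in> t)) \<le> real T" .
    have sum_eq: "sum (accept n c (truncate (Sample k) q)) S
        = (\<Sum>(b, i)\<in>triples n \<times> {..<3}. sum (F c b i) S) / (3 * real m)" for c S
    proof -
      have "accept n c (truncate (Sample k) q) \<pi>
          = (\<Sum>(b, i)\<in>triples n \<times> {..<3}. F c b i \<pi>) / (3 * real m)" for \<pi>
        unfolding Suc truncate.simps nat.case accept_Sample[OF n] F_def m_def ..
      then have "sum (accept n c (truncate (Sample k) q)) S
          = (\<Sum>\<pi>\<in>S. \<Sum>(b, i)\<in>triples n \<times> {..<3}. F c b i \<pi>) / (3 * real m)"
        by (simp add: sum_divide_distrib)
      also have "(\<Sum>\<pi>\<in>S. \<Sum>(b, i)\<in>triples n \<times> {..<3}. F c b i \<pi>)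
          = (\<Sum>(b, i)\<in>triples n \<times> {..<3}. sum (F c b i) S)"
        unfolding case_prod_beta by (rule sum.swap)
      finally show ?thesis .
    qed
    have "\<bar>(\<Sum>(b, i)\<in>triples n \<times> {..<3}. sum (F False b i) (extensions n X f))
        - (\<Sum>(b, i)\<in>triples n \<times> {..<3}. sum (F True b i) (extensions n X g))\<bar>
        \<le> (\<Sum>(b, i)\<in>triples n \<times> {..<3}. ?d b i)"
      unfolding case_prod_beta sum_subtractf[symmetric] by (rule sum_abs)
    also have "\<dots> \<le> (\<Sum>(b, i)\<in>triples n \<times> {..<3 :: nat}. (of_bool (b \<in> t) + \<Delta>) * fact (n - card X))"
      using each by (intro sum_mono) auto
    also have "\<dots> = (\<Sum>b\<in>triples n. \<Sum>i\<in>{..<3 :: nat}. (of_bool (b \<in> t) + \<Delta>) * fact (n - card X))"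
      by (rule sum.cartesian_product[symmetric])
    also have "\<dots> = 3 * ((\<Sum>b\<in>triples n. of_bool (b \<in> t)) + real m * \<Delta>) * fact (n - card X)"
      by (simp only: sum_constant card_lessThan sum.distrib sum_distrib_left[symmetric]
          sum_distrib_right[symmetric] m_def of_nat_numeral mult.assoc)
    also have "\<dots> \<le> 3 * (real T + real m * \<Delta>) * fact (n - card X)"
      using touched by (intro mult_right_mono mult_left_mono add_right_mono) simp_all
    finally have "\<bar>(\<Sum>(b, i)\<in>triples n \<times> {..<3}. sum (F False b i) (extensions n X f))
        - (\<Sum>(b, i)\<in>triples n \<times> {..<3}. sum (F True b i) (extensions n X g))\<bar> / (3 * real m)
        \<le> 3 * (real T + real m * \<Delta>) * fact (n - card X) / (3 * real m)"
      by (rule divide_right_mono) simp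
    also have "\<dots> = (real T / real m + \<Delta>) * fact (n - card X)"
      using \<open>m > 0\<close> by (simp add: field_simps)
    also have "\<dots> \<le> real q * (12 * real T / real n) * fact (n - card X)"
    proof (rule mult_right_mono)
      have "real T * real n \<le> real T * (12 * real m)"
        using m by (intro mult_left_mono) simp_all
      then have "real T / real m \<le> 12 * real T / real n"
        using \<open>m > 0\<close> \<open>n > 0\<close> by (simp add: divide_simps mult_ac)
      then show "real T / real m + \<Delta> \<le> real q * (12 * real T / real n)"
        unfolding \<Delta>_def Suc of_nat_Suc distrib_right mult_1 by linarith
    qed simp
    finally show ?thesis
      unfolding sum_eq diff_divide_distrib[symmetric] abs_divide by simp
  qed
qed

text \<open>Yao's principle with a uniform \<pi>: correctness forces a gap of 1/3 between the cases
  for every \<pi>, hence on average. For each deterministic strategy, \<open>accept_close\<close>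
  with T = 2Q bounds the average gap by 24Q^2/n, which is too small if Q \<le> sqrt(n)/9.\<close>

lemma query_lower_bound:
  assumes n: "n \<ge> 16" and \<epsilon>: "\<epsilon> \<le> 1 / 3"
    and tester: "distribution_free_tester n \<epsilon> A" and queries: "makes_at_most_queries n A B"
  shows "B \<ge> 1 / 9 * sqrt (real n)"
proof (rule ccontr)
  assume B: "\<not> ?thesis"
  define perms where "perms = {\<pi>. \<pi> permutes {1..n}}"
  have perms: "extensions n {} id = perms" by (simp add: extensions_def perms_def)
  have card: "card perms = fact n" by (simp add: perms_def card_permutations)
  have valid: "comparison_function n (hidden_order n c \<pi>)" "pair_distribution n (hidden_pairs n \<pi>)"
    if "\<pi> \<in> perms" for \<pi> c
    using that comparison_hidden_order pair_distribution_hidden_pairs n by (auto simp: perms_def)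
  have bound: "real r \<le> B"
    if "\<pi> \<in> perms" "(b, r) \<in> set_pmf (execute A (hidden_order n c \<pi>) (hidden_pairs n \<pi>))" for \<pi> b r c
    using queries valid[OF that(1)] that(2) unfolding makes_at_most_queries_def by blast
  \<comment> \<open>Any single outcome shows that \<open>B\<close> is nonnegative, so that
    \<open>Q\<close> is its true integer part.\<close>
  have "id \<in> perms" by (simp add: perms_def permutes_id)
  moreover obtain b r where "(b, r) \<in> set_pmf (execute A (hidden_order n True id) (hidden_pairs n id))"
    using set_pmf_not_empty by (metis ex_in_conv surj_pair)
  ultimately have "real r \<le> B" by (rule bound)
  then have "B \<ge> 0" by linarith
  define Q where "Q = nat \<lfloor>B\<rfloor>"
  have Q: "real Q \<le> sqrt (real n) / 9" using \<open>B \<ge> 0\<close> B unfolding Q_def by linarith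
  have "(real Q)\<^sup>2 \<le> (sqrt (real n) / 9)\<^sup>2" using Q by (intro power_mono) simp_all
  then have Q2: "81 * (real Q * real Q) \<le> real n" by (simp add: power2_eq_square)
  have QQ: "real Q \<le> real Q * real Q" by (cases Q) simp_all
  have "2 * (2 * Q) \<le> n" using Q2 QQ by linarith
  have accept_truncate: "accept n c (truncate s Q) \<pi> = accept n c s \<pi>"
    if s: "s \<in> set_pmf A" and \<pi>: "\<pi> \<in> perms" for s \<pi> c
  proof -
    have "r \<le> Q" if "(b, r) \<in> set_pmf (run (hidden_order n c \<pi>) (hidden_pairs n \<pi>) s)" for b r
    proof -
      have "real r \<le> B" using bound[OF \<pi>, of b r c] s that by (auto simp: execute_def)
      then show ?thesis unfolding Q_def by linarith
    qed
    then have "run (hidden_order n c \<pi>) (hidden_pairs n \<pi>) (truncate s Q)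
        = run (hidden_order n c \<pi>) (hidden_pairs n \<pi>) s" by (rule run_truncate)
    then show ?thesis by (simp only: flip: prob_run_accept)
  qed
  define gap where "gap s = (\<Sum>\<pi>\<in>perms. accept n False s \<pi> - accept n True s \<pi>)" for s
  have gap: "gap s \<le> 24 / 81 * fact n" if s: "s \<in> set_pmf A" for s
  proof -
    have "coupled n {} id id" by (simp add: coupled_def partial_injection_def)
    from accept_close[OF n \<open>2 * (2 * Q) \<le> n\<close> this, of Q s]
    have "\<bar>sum (accept n False (truncate s Q)) perms - sum (accept n True (truncate s Q)) perms\<bar>
        \<le> real Q * (12 * real (2 * Q) / real n) * fact n" by (simp add: perms)
    moreover have "gap s = sum (accept n False (truncate s Q)) perms - sum (accept n True (truncate s Q)) perms"
      unfolding gap_def sum_subtractf using accept_truncate[OF s] by simp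
    \<comment> \<open>From 81Q^2 \<le> n; the constant 1/9 is chosen such that 24/81 is less than
      1/3 = 27/81.\<close>
    moreover have "real Q * (12 * real (2 * Q) / real n) * fact n \<le> 24 / 81 * fact n"
      using Q2 n by (intro mult_right_mono) (simp_all add: divide_simps)
    ultimately show ?thesis by linarith
  qed
  have int: "integrable (measure_pmf A) (\<lambda>s. accept n c s \<pi>)" for c \<pi>
    by (rule measure_pmf.integrable_const_bound[where B = 1])
      (auto simp: acceptance_nonneg acceptance_le_1)
  have int_gap: "integrable (measure_pmf A) gap"
    unfolding gap_def by (intro Bochner_Integration.integrable_sum Bochner_Integration.integrable_diff int)
  have "1 / 3 \<le> measure_pmf.expectation A (\<lambda>s. accept n False s \<pi> - accept n True s \<pi>)"
    if "\<pi> \<in> perms" for \<pi>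
  proof -
    have perm: "\<pi> permutes {1..n}" using that by (simp add: perms_def)
    have "2 / 3 \<le> measure_pmf.expectation A (\<lambda>s. accept n False s \<pi>)"
      using tester valid[OF that] total_hidden_order[OF perm]
      unfolding distribution_free_tester_def prob_execute_accept by blast
    moreover have "2 / 3 \<le> 1 - measure_pmf.expectation A (\<lambda>s. accept n True s \<pi>)"
      using tester valid[OF that] far_hidden_order[OF perm n \<epsilon>]
      unfolding distribution_free_tester_def prob_reject prob_execute_accept by blast
    ultimately show ?thesis by (simp add: int)
  qed
  then have "(\<Sum>\<pi>\<in>perms. 1 / 3)
      \<le> (\<Sum>\<pi>\<in>perms. measure_pmf.expectation A (\<lambda>s. accept n False s \<pi> - accept n True s \<pi>))"
    by (intro sum_mono)
  also have "\<dots> = measure_pmf.expectation A gap"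
    unfolding gap_def by (subst Bochner_Integration.integral_sum) (simp_all add: int)
  also have "\<dots> \<le> measure_pmf.expectation A (\<lambda>_. 24 / 81 * fact n)"
    using gap int_gap by (intro integral_mono_AE) (simp_all add: AE_measure_pmf_iff)
  finally have "fact n / 3 \<le> (24 / 81 * fact n :: real)" by (simp add: card)
  moreover have "(0 :: real) < fact n" by simp
  ultimately show False by linarith
qed

theorem theorem1p4:
  "(\<exists>(A :: nat \<Rightarrow> real \<Rightarrow> strategy pmf) (C :: real) (k :: nat). C > 0 \<and>
      (\<forall>n \<epsilon>. \<epsilon> > 0 \<longrightarrow>
         distribution_free_tester n \<epsilon> (A n \<epsilon>) \<and>
         makes_at_most_queries n (A n \<epsilon>) (soft_bound C k (sqrt (real n) / \<epsilon>)))) \<and>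
   (\<exists>\<epsilon>\<^sub>0 > 0. \<forall>\<epsilon> :: real. 0 < \<epsilon> \<and> \<epsilon> \<le> \<epsilon>\<^sub>0 \<longrightarrow>
      (\<exists>c > 0. \<forall>\<^sub>F n in sequentially. \<forall>(A :: strategy pmf) (B :: real).
         distribution_free_tester n \<epsilon> A \<and> makes_at_most_queries n A B \<longrightarrow>
         B \<ge> c * sqrt (real n)))"
proof (intro conjI)
  show "\<exists>(A :: nat \<Rightarrow> real \<Rightarrow> strategy pmf) (C :: real) (k :: nat). C > 0 \<and>
      (\<forall>n \<epsilon>. \<epsilon> > 0 \<longrightarrow>
         distribution_free_tester n \<epsilon> (A n \<epsilon>) \<and>
         makes_at_most_queries n (A n \<epsilon>) (soft_bound C k (sqrt (real n) / \<epsilon>)))"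
    using distribution_free_tester_tester makes_at_most_queries_tester
    by (intro exI[of _ "\<lambda>n \<epsilon>. return_pmf (tester n \<epsilon>)"] exI[of _ 80000] exI[of _ 1]) simp
  show "\<exists>\<epsilon>\<^sub>0 > 0. \<forall>\<epsilon> :: real. 0 < \<epsilon> \<and> \<epsilon> \<le> \<epsilon>\<^sub>0 \<longrightarrow>
      (\<exists>c > 0. \<forall>\<^sub>F n in sequentially. \<forall>(A :: strategy pmf) (B :: real).
         distribution_free_tester n \<epsilon> A \<and> makes_at_most_queries n A B \<longrightarrow>
         B \<ge> c * sqrt (real n))"
  proof (rule exI[of _ "1 / 3"], intro conjI allI impI)
    fix \<epsilon> :: real assume "0 < \<epsilon> \<and> \<epsilon> \<le> 1 / 3"
    then have "\<forall>\<^sub>F n in sequentially. \<forall>(A :: strategy pmf) (B :: real).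
         distribution_free_tester n \<epsilon> A \<and> makes_at_most_queries n A B \<longrightarrow>
         B \<ge> 1 / 9 * sqrt (real n)"
      using query_lower_bound by (intro eventually_sequentiallyI[of 16]) blast
    then show "\<exists>c > 0. \<forall>\<^sub>F n in sequentially. \<forall>(A :: strategy pmf) (B :: real).
         distribution_free_tester n \<epsilon> A \<and> makes_at_most_queries n A B \<longrightarrow>
         B \<ge> c * sqrt (real n)"
      by (intro exI[of _ "1 / 9"] conjI) simp_all
  qed simp
qed

end
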